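(* Let $\Omega\subset\mathbb R^d$, $d\in\{2,3\}$, be a bounded polygonal (polyhedral) domain with a conforming simplicial triangulation $\mathcal T_h$, and let $X_h=V_h\times Q_h$ be the equal-order $P_1$ finite element space. Let $T\in L(Q_h,Q_h')$ be given by $$\langle Tp,q\rangle_{Q_h',Q_h}=\int_\Omega\bigl(I_h^1(pq)-pq\bigr),$$ and let $A_h\in L(X_h,X_h')$ be the stabilized Stokes operator $$\langle A_h(u,p),(v,q)\rangle=\int_\Omega\nabla u:\nabla v-\int_\Omega p\,\mathrm{div}\,v+\int_\Omega q\,\mathrm{div}\,u+\langle Tp,q\rangle .$$ Then $A_h$ is linearly mapped coercive.
   Context: $V=H^1_0(\Omega)^d$ with $\|u\|_V=\|\nabla u\|_{L^2(\Omega)}$; $Q=L^2_0(\Omega)$, the $L^2$ functions with zero mean, with the $L^2$ norm. $V_h\subset V$ is the space of continuous piecewise linear $\mathbb R^d$-valued functions vanishing on $\partial\Omega$; $Q_h\subset Q$ is the space of continuous piecewise linear functions with zero mean. $I_h^1$ is the nodal Lagrange interpolation operator from continuous functions on $\overline\Omega$ into continuous piecewise linear functions on $\mathcal T_h$. $X_h$ carries the product norm. An operator $A:X\to Y'$ is called linearly mapped coercive if there is a bounded linear surjective map $\Phi\in L(X,Y)$ such that $\liminf_{\|x\|_X\to\infty}\frac{\langle A(x),\Phi x\rangle_{Y',Y}}{\|x\|_X}=+\infty$; here $X$ and $Y$ are both replaced by $X_h$. *)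

theory Defs
  imports "HOL-Analysis.Analysis" "HOL-Library.Function_Algebras"
begin

text \<open>Pointwise scalar multiplication (addition is pointwise by \<open>Function_Algebras\<close>), so that
  finite element spaces are linear subspaces of function types in the sense of \<^const>\<open>subspace\<close>.\<close>

instantiation "fun" :: (type, real_vector) real_vector
begin

definition scaleR_fun :: "real \<Rightarrow> ('a \<Rightarrow> 'b) \<Rightarrow> 'a \<Rightarrow> 'b"
  where "scaleR_fun c f = (\<lambda>x. c *\<^sub>R f x)"

instance
  by standard
    (simp_all add: scaleR_fun_def plus_fun_def fun_eq_iff scaleR_add_right scaleR_add_left)

end


section \<open>Operators between normed spaces given by a carrier and a norm\<close>

text \<open>The finite element spaces depend on a domain and a mesh and so are not types. A normed space
  is given by a carrier \<open>X\<close> (a linear subspace of the ambient type) and a norm \<open>N\<close> on it;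
  the values of maps outside the carrier are irrelevant.\<close>

definition linear_map_on :: "'a::real_vector set \<Rightarrow> ('a \<Rightarrow> 'b::real_vector) \<Rightarrow> bool" where
  "linear_map_on X f \<longleftrightarrow>
     (\<forall>x\<in>X. \<forall>y\<in>X. f (x + y) = f x + f y) \<and> (\<forall>c. \<forall>x\<in>X. f (c *\<^sub>R x) = c *\<^sub>R f x)"

definition bounded_linear_maps ::
  "'a::real_vector set \<Rightarrow> ('a \<Rightarrow> real) \<Rightarrow> 'b::real_vector set \<Rightarrow> ('b \<Rightarrow> real) \<Rightarrow> ('a \<Rightarrow> 'b) set" where
  "bounded_linear_maps X NX Y NY =
     {\<Phi>. \<Phi> ` X \<subseteq> Y \<and> linear_map_on X \<Phi> \<and> (\<exists>C. \<forall>x\<in>X. NY (\<Phi> x) \<le> C * NX x)}"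

definition dual_space :: "'b::real_vector set \<Rightarrow> ('b \<Rightarrow> real) \<Rightarrow> ('b \<Rightarrow> real) set" where
  "dual_space Y NY = bounded_linear_maps Y NY UNIV norm"

text \<open>\<open>L(X, Y')\<close>, where \<open>A x y\<close> is the duality pairing of \<open>A x \<in> Y'\<close> with \<open>y\<close>. The bound says that
  the dual norm of \<open>A x\<close> is at most \<open>C * NX x\<close>.\<close>

definition bounded_linear_maps_to_dual ::
  "'a::real_vector set \<Rightarrow> ('a \<Rightarrow> real) \<Rightarrow> 'b::real_vector set \<Rightarrow> ('b \<Rightarrow> real) \<Rightarrow> ('a \<Rightarrow> 'b \<Rightarrow> real) set" where
  "bounded_linear_maps_to_dual X NX Y NY =
     {A. A ` X \<subseteq> dual_space Y NY \<and> (\<forall>y\<in>Y. linear_map_on X (\<lambda>x. A x y)) \<and>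
         (\<exists>C. \<forall>x\<in>X. \<forall>y\<in>Y. \<bar>A x y\<bar> \<le> C * NX x * NY y)}"

text \<open>The filter expresses \<open>NX x \<rightarrow> \<infinity>\<close> with \<open>x \<in> X\<close>. The operator \<open>A\<close> need not be linear.\<close>

definition linearly_mapped_coercive ::
  "'a::real_vector set \<Rightarrow> ('a \<Rightarrow> real) \<Rightarrow> 'b::real_vector set \<Rightarrow> ('b \<Rightarrow> real) \<Rightarrow> ('a \<Rightarrow> 'b \<Rightarrow> real) \<Rightarrow> bool" where
  "linearly_mapped_coercive X NX Y NY A \<longleftrightarrow>
     A ` X \<subseteq> dual_space Y NY \<and>
     (\<exists>\<Phi> \<in> bounded_linear_maps X NX Y NY. \<Phi> ` X = Y \<and>
        Liminf (inf (filtercomap NX at_top) (principal X)) (\<lambda>x. ereal (A x (\<Phi> x) / NX x)) = \<infinity>)"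


section \<open>Domains, meshes and \<open>P\<^sub>1\<close> finite elements\<close>

definition polyhedral_domain :: "'a::euclidean_space set \<Rightarrow> bool" where
  "polyhedral_domain \<Omega> \<longleftrightarrow>
     open \<Omega> \<and> connected \<Omega> \<and> \<Omega> \<noteq> {} \<and> bounded \<Omega> \<and>
     (\<exists>F. finite F \<and> (\<forall>P\<in>F. polytope P \<and> aff_dim P = int DIM('a) - 1) \<and> frontier \<Omega> = \<Union>F)"

text \<open>Conformity (the intersection of two elements is a common, possibly empty, face) is part of
  \<^const>\<open>triangulation\<close>.\<close>

definition conforming_mesh :: "'a::euclidean_space set \<Rightarrow> 'a set set \<Rightarrow> bool" where
  "conforming_mesh \<Omega> \<T> \<longleftrightarrow>
     triangulation \<T> \<and> (\<forall>K\<in>\<T>. int DIM('a) simplex K) \<and> \<Union>\<T> = closure \<Omega>"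

text \<open>Continuous piecewise linear functions on \<open>\<Union>\<T> = closure \<Omega>\<close>. They are normalised to vanish
  off that set, so that equality and linear operations are those of functions on \<open>closure \<Omega>\<close>.\<close>

definition P1 :: "'a::euclidean_space set set \<Rightarrow> ('a \<Rightarrow> 'b::real_normed_vector) set" where
  "P1 \<T> = {f. continuous_on (\<Union>\<T>) f \<and>
              (\<forall>K\<in>\<T>. \<exists>a L. linear L \<and> (\<forall>x\<in>K. f x = a + L x)) \<and>
              (\<forall>x. x \<notin> \<Union>\<T> \<longrightarrow> f x = 0)}"

definition mesh_nodes :: "'a::euclidean_space set set \<Rightarrow> 'a set" where
  "mesh_nodes \<T> = {v. \<exists>K\<in>\<T>. v extreme_point_of K}"

definition lagrange_interp :: "'a::euclidean_space set set \<Rightarrow> ('a \<Rightarrow> real) \<Rightarrow> 'a \<Rightarrow> real" where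
  "lagrange_interp \<T> f = (THE g. g \<in> P1 \<T> \<and> (\<forall>v\<in>mesh_nodes \<T>. g v = f v))"

definition Vh :: "(real^'d) set \<Rightarrow> (real^'d) set set \<Rightarrow> (real^'d \<Rightarrow> real^'d) set" where
  "Vh \<Omega> \<T> = {u \<in> P1 \<T>. \<forall>x\<in>frontier \<Omega>. u x = 0}"

definition Qh :: "(real^'d) set \<Rightarrow> (real^'d) set set \<Rightarrow> (real^'d \<Rightarrow> real) set" where
  "Qh \<Omega> \<T> = {p \<in> P1 \<T>. (LINT x:\<Omega>|lebesgue. p x) = 0}"

definition Xh :: "(real^'d) set \<Rightarrow> (real^'d) set set \<Rightarrow>
    ((real^'d \<Rightarrow> real^'d) \<times> (real^'d \<Rightarrow> real)) set" where
  "Xh \<Omega> \<T> = Vh \<Omega> \<T> \<times> Qh \<Omega> \<T>"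

text \<open>\<open>\<nabla>u(x)\<close> is \<open>jacobian u (at x)\<close> (entry \<open>$ i $ j\<close> is the derivative of \<open>u\<^sub>i\<close> in direction \<open>j\<close>).
  For \<open>u \<in> P1 \<T>\<close> it exists in the interior of every element, hence almost everywhere in \<open>\<Omega>\<close>, where it
  is the elementwise, and therefore weak, gradient; null sets do not affect the integrals. The norm
  and inner product of \<open>real^'d^'d\<close> are the Frobenius ones, so \<open>\<bullet>\<close> is the contraction \<open>\<nabla>u : \<nabla>v\<close>.\<close>

definition div_at :: "(real^'d \<Rightarrow> real^'d) \<Rightarrow> real^'d \<Rightarrow> real" where
  "div_at u x = trace (jacobian u (at x))"

definition normV :: "(real^'d) set \<Rightarrow> (real^'d \<Rightarrow> real^'d) \<Rightarrow> real" where
  "normV \<Omega> u = sqrt (LINT x:\<Omega>|lebesgue. (norm (jacobian u (at x)))\<^sup>2)"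

definition normQ :: "(real^'d) set \<Rightarrow> (real^'d \<Rightarrow> real) \<Rightarrow> real" where
  "normQ \<Omega> p = sqrt (LINT x:\<Omega>|lebesgue. (p x)\<^sup>2)"

definition normX :: "(real^'d) set \<Rightarrow> (real^'d \<Rightarrow> real^'d) \<times> (real^'d \<Rightarrow> real) \<Rightarrow> real" where
  "normX \<Omega> = (\<lambda>(u, p). sqrt ((normV \<Omega> u)\<^sup>2 + (normQ \<Omega> p)\<^sup>2))"


section \<open>The stabilized Stokes operator\<close>

definition stab_op :: "(real^'d) set \<Rightarrow> (real^'d) set set \<Rightarrow>
    (real^'d \<Rightarrow> real) \<Rightarrow> (real^'d \<Rightarrow> real) \<Rightarrow> real" where
  "stab_op \<Omega> \<T> p q = (LINT x:\<Omega>|lebesgue. lagrange_interp \<T> (\<lambda>y. p y * q y) x - p x * q x)"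

definition stokes_op :: "(real^'d) set \<Rightarrow> (real^'d) set set \<Rightarrow>
    (real^'d \<Rightarrow> real^'d) \<times> (real^'d \<Rightarrow> real) \<Rightarrow> (real^'d \<Rightarrow> real^'d) \<times> (real^'d \<Rightarrow> real) \<Rightarrow> real" where
  "stokes_op \<Omega> \<T> = (\<lambda>(u, p) (v, q).
      (LINT x:\<Omega>|lebesgue. jacobian u (at x) \<bullet> jacobian v (at x))
    - (LINT x:\<Omega>|lebesgue. p x * div_at v x)
    + (LINT x:\<Omega>|lebesgue. q x * div_at u x)
    + stab_op \<Omega> \<T> p q)"

end

theory Submission
  imports Defs
begin

text \<open>The map \<open>\<Phi> = id\<close> already works. The divergence terms cancel on the diagonal, so
  \<open>\<langle>A\<^sub>h(u, p), (u, p)\<rangle> = \<parallel>\<nabla>u\<parallel>\<^sup>2 + \<langle>Tp, p\<rangle>\<close>. On each element \<open>p\<^sup>2\<close> is convex, so it lies below its nodal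
  interpolant, with equality only if \<open>p\<close> is constant there; hence \<open>T\<close> is positive semidefinite, and
  \<open>\<langle>Tp, p\<rangle> = 0\<close> forces \<open>p\<close> to be constant on the connected domain, i.e. zero by the mean value
  condition. So the diagonal of \<open>A\<^sub>h\<close> is a positive definite quadratic form on a finite-dimensional
  space, and dominates the squared norm; no inf-sup condition is needed.\<close>

section \<open>Bilinear forms on finite-dimensional subspaces\<close>

text \<open>The spaces are carriers inside function types, so the equivalence of norms in finite
  dimension is made explicit by an expansion in unit vectors. The resulting estimate
  \<open>bilinear_bound\<close> is used in both directions: measured by the norm form it bounds the
  two operators, and with the diagonal form as the measuring inner product it bounds the squared
  norm, which is coercivity. The constant comes from this argument and may depend on the mesh. The
  other difficulty is that Jacobians are controlled only inside elements, whereas the definiteness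
  arguments need information at edges and vertices. Integrals are therefore evaluated on an open set
  \<open>W\<close> of full measure, and pointwise identities obtained there are carried to all of
  \<open>closure \<Omega>\<close> by continuity and density. The strictness of the convexity
  argument is read off at the midpoint of two vertices of an element.\<close>

definition bilinear_on :: "'a::real_vector set \<Rightarrow> ('a \<Rightarrow> 'a \<Rightarrow> real) \<Rightarrow> bool" where
  "bilinear_on X b \<longleftrightarrow>
     (\<forall>y\<in>X. linear_map_on X (\<lambda>x. b x y)) \<and> (\<forall>x\<in>X. linear_map_on X (b x))"

lemma bilinear_onI_sym:
  assumes "\<And>x y z. \<lbrakk>x \<in> X; y \<in> X; z \<in> X\<rbrakk> \<Longrightarrow> b (x + y) z = b x z + b y z"
    and "\<And>c x z. \<lbrakk>x \<in> X; z \<in> X\<rbrakk> \<Longrightarrow> b (c *\<^sub>R x) z = c * b x z"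
    and "\<And>x y. b x y = b y x"
    and "subspace X"
  shows "bilinear_on X b"
  using assms unfolding bilinear_on_def linear_map_on_def
  by (metis real_scaleR_def)

lemma linear_map_on_sum:
  assumes f: "linear_map_on X f" and X: "subspace X" and "finite E" "\<And>i. i \<in> E \<Longrightarrow> g i \<in> X"
  shows "f (\<Sum>i\<in>E. c i *\<^sub>R g i) = (\<Sum>i\<in>E. c i *\<^sub>R f (g i))"
  using assms(3,4)
proof (induction E)
  case empty
  have "f (0 *\<^sub>R 0) = 0 *\<^sub>R f 0"
    using f subspace_0[OF X] unfolding linear_map_on_def by blast
  then show ?case by simp
next
  case (insert i E)
  have "(\<Sum>i\<in>E. c i *\<^sub>R g i) \<in> X" "c i *\<^sub>R g i \<in> X"
    using insert.prems X by (auto intro: subspace_sum subspace_scale)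
  then show ?case
    using f insert unfolding linear_map_on_def by simp
qed

text \<open>Instances are the forms behind the norms and the form on the diagonal of the Stokes
  operator; treating both alike is what allows comparing them.\<close>

locale inner_product_on =
  fixes X :: "'a::real_vector set" and a :: "'a \<Rightarrow> 'a \<Rightarrow> real"
  assumes X: "subspace X"
    and bil: "bilinear_on X a"
    and sym: "\<lbrakk>x \<in> X; y \<in> X\<rbrakk> \<Longrightarrow> a x y = a y x"
    and nonneg: "x \<in> X \<Longrightarrow> a x x \<ge> 0"
    and definite: "\<lbrakk>x \<in> X; a x x = 0\<rbrakk> \<Longrightarrow> x = 0"
begin

lemma add_left: "\<lbrakk>x \<in> X; y \<in> X; z \<in> X\<rbrakk> \<Longrightarrow> a (x + y) z = a x z + a y z"
  and scale_left: "\<lbrakk>x \<in> X; z \<in> X\<rbrakk> \<Longrightarrow> a (c *\<^sub>R x) z = c * a x z"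
  and add_right: "\<lbrakk>x \<in> X; y \<in> X; z \<in> X\<rbrakk> \<Longrightarrow> a z (x + y) = a z x + a z y"
  and scale_right: "\<lbrakk>x \<in> X; z \<in> X\<rbrakk> \<Longrightarrow> a z (c *\<^sub>R x) = c * a z x"
  using bil unfolding bilinear_on_def linear_map_on_def by auto

lemma diff_left: "\<lbrakk>x \<in> X; y \<in> X; z \<in> X\<rbrakk> \<Longrightarrow> a (x - y) z = a x z - a y z"
  using add_left[of x "(-1) *\<^sub>R y" z] scale_left[of y z "-1"] subspace_neg[OF X, of y] by simp

lemma diff_right: "\<lbrakk>x \<in> X; y \<in> X; z \<in> X\<rbrakk> \<Longrightarrow> a z (x - y) = a z x - a z y"
  using add_right[of x "(-1) *\<^sub>R y" z] scale_right[of y z "-1"] subspace_neg[OF X, of y] by simp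

text \<open>Cauchy-Schwarz against a unit vector: the remainder of \<open>x\<close> after projection
  onto \<open>e\<close> has nonnegative square.\<close>

lemma abs_le_of_unit:
  assumes "x \<in> X" "e \<in> X" "a e e = 1"
  shows "\<bar>a x e\<bar> \<le> sqrt (a x x)"
proof -
  define t where "t = a x e"
  have "a (x - t *\<^sub>R e) (x - t *\<^sub>R e) = a x x - t\<^sup>2"
    using assms X sym[of x e]
    by (simp add: diff_left diff_right scale_left scale_right subspace_scale subspace_diff
        t_def power2_eq_square algebra_simps)
  then have "t\<^sup>2 \<le> a x x"
    using nonneg[of "x - t *\<^sub>R e"] assms X by (simp add: subspace_scale subspace_diff)
  then show ?thesis
    using real_sqrt_le_mono[of "t\<^sup>2"] by (simp add: t_def)
qed

text \<open>Gram-Schmidt. Instead of orthogonality the induction carries the reproducing formula,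
  which is the form in which the result is applied.\<close>

lemma unit_expansion:
  assumes "finite S" "S \<subseteq> X"
  shows "\<exists>E. finite E \<and> E \<subseteq> span S \<and> (\<forall>i\<in>E. a i i = 1) \<and>
             (\<forall>x\<in>span S. (\<Sum>i\<in>E. a x i *\<^sub>R i) = x)"
  using assms
proof (induction S)
  case empty
  then show ?case by (intro exI[of _ "{}"]) simp
next
  case (insert e S)
  then have "S \<subseteq> X" by simp
  with insert.IH obtain E where E: "finite E" "E \<subseteq> span S" "\<And>i. i \<in> E \<Longrightarrow> a i i = 1"
    and ex: "\<And>x. x \<in> span S \<Longrightarrow> (\<Sum>i\<in>E. a x i *\<^sub>R i) = x"
    by blast
  have SX: "span S \<subseteq> X" and eX: "e \<in> X"
    using insert.prems X by (auto simp: span_minimal)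
  have EX: "i \<in> X" if "i \<in> E" for i using that E SX by auto
  define P where "P = (\<Sum>i\<in>E. a e i *\<^sub>R i)"
  have PS: "P \<in> span S" unfolding P_def using E by (auto intro!: span_sum span_scale)
  define w where "w = e - P"
  have wX: "w \<in> X" using PS SX eX X by (auto simp: w_def subspace_diff)
  show ?case
  proof (cases "w = 0")
    case True
    then have "span (insert e S) = span S"
      using PS by (simp add: w_def span_redundant)
    then show ?thesis using E ex by (metis (no_types))
  next
    case False
    \<comment> \<open>Expanding \<open>P\<close> and using symmetry moves the sum to the second
      argument, where the reproducing formula for \<open>i\<close> itself collapses it to
      \<open>a e i\<close>.\<close>
    have orth: "a w i = 0" if i: "i \<in> E" for i
    proof -
      have "a P i = (\<Sum>j\<in>E. a e j *\<^sub>R a j i)"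
        unfolding P_def using bil EX[OF i] E(1) EX X
        by (intro linear_map_on_sum[where X = X]) (auto simp: bilinear_on_def)
      also have "\<dots> = (\<Sum>j\<in>E. a i j *\<^sub>R a e j)"
        using sym EX[OF i] EX by (intro sum.cong) auto
      also have "\<dots> = a e (\<Sum>j\<in>E. a i j *\<^sub>R j)"
        using bil eX E(1) EX X
        by (intro linear_map_on_sum[where X = X, symmetric]) (auto simp: bilinear_on_def)
      also have "\<dots> = a e i" using ex[of i] E(2) i by auto
      finally show ?thesis
        using EX[OF i] eX PS SX by (auto simp: w_def diff_left)
    qed
    have pos: "a w w > 0" using nonneg[OF wX] definite[OF wX] False by (metis less_eq_real_def)
    define r where "r = sqrt (a w w)"
    have r: "r > 0" "r * r = a w w" using pos by (auto simp: r_def)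
    define n where "n = inverse r *\<^sub>R w"
    have wn: "w = r *\<^sub>R n" using r by (simp add: n_def)
    have nX: "n \<in> X" using wX X by (simp add: n_def subspace_scale)
    have nE: "a n i = 0" if "i \<in> E" for i
      using orth[OF that] wX EX[OF that] by (simp add: n_def scale_left)
    have "a n n = inverse r * (inverse r * a w w)"
      using wX nX unfolding n_def by (simp only: scale_left scale_right)
    then have nn: "a n n = 1"
      unfolding r(2)[symmetric] using r(1) by (simp add: field_simps)
    have "n \<notin> E" using nE nn by (metis zero_neq_one)
    have nS: "a n z = 0" if z: "z \<in> span S" for z
    proof -
      have "a n (\<Sum>i\<in>E. a z i *\<^sub>R i) = (\<Sum>i\<in>E. a z i *\<^sub>R a n i)"
        using bil nX E(1) EX X by (intro linear_map_on_sum[where X = X]) (auto simp: bilinear_on_def)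
      then show ?thesis using ex[OF z] nE by simp
    qed
    have "(\<Sum>i\<in>insert n E. a x i *\<^sub>R i) = x" if x: "x \<in> span (insert e S)" for x
    proof -
      obtain k where k: "x - k *\<^sub>R e \<in> span S" using x span_breakdown_eq by blast
      \<comment> \<open>Since \<open>e = w + P\<close>, the multiple of \<open>P\<close> is absorbed
        here, which leaves exactly \<open>k *\<^sub>R w = (k * r) *\<^sub>R n\<close> outside
        \<open>span S\<close>.\<close>
      define z where "z = x - k *\<^sub>R e + k *\<^sub>R P"
      have z: "z \<in> span S" unfolding z_def using k PS by (simp add: span_add span_scale)
      have zX: "z \<in> X" using z SX by auto
      have xz: "x = (k * r) *\<^sub>R n + z"
        using wn by (simp add: z_def w_def algebra_simps flip: scaleR_scaleR)
      have "a x n = k * r"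
        using nn nS[OF z] sym[OF zX nX] nX zX X
        by (simp add: xz add_left scale_left subspace_scale)
      moreover have "a x i = a z i" if "i \<in> E" for i
        using nE[OF that] EX[OF that] nX zX X by (simp add: xz add_left scale_left subspace_scale)
      ultimately show ?thesis
        using ex[OF z] xz \<open>n \<notin> E\<close> E(1) by simp
    qed
    moreover have "insert n E \<subseteq> span (insert e S)"
    proof -
      have "P \<in> span (insert e S)" "E \<subseteq> span (insert e S)"
        using PS E(2) span_mono[of S "insert e S"] by auto
      then show ?thesis by (simp add: n_def w_def span_scale span_diff span_base)
    qed
    ultimately show ?thesis
      using E(1,3) nn by (intro exI[of _ "insert n E"]) auto
  qed
qed

text \<open>Expanding both arguments in the unit vectors leaves coefficients bounded by the norms,
  so the sum of the absolute matrix entries of \<open>b\<close> is a bound.\<close>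

lemma bilinear_bound:
  assumes b: "bilinear_on X b" and fin: "finite B" "X \<subseteq> span B"
  obtains C where "C > 0" "\<And>x y. \<lbrakk>x \<in> X; y \<in> X\<rbrakk> \<Longrightarrow> \<bar>b x y\<bar> \<le> C * sqrt (a x x) * sqrt (a y y)"
proof -
  \<comment> \<open>\<open>B\<close> may lie outside \<open>X\<close>, where \<open>a\<close> is
    uncontrolled. A maximal independent subset of \<open>X\<close> stays inside and is finite
    because \<open>B\<close> spans it.\<close>
  obtain S where S: "S \<subseteq> X" "independent S" "X \<subseteq> span S"
    using maximal_independent_subset by blast
  then have "finite S" using fin independent_span_bound by blast
  moreover have "span S = X" using S X by (simp add: span_minimal subset_antisym)
  ultimately obtain E where E: "finite E" "E \<subseteq> X" "\<And>i. i \<in> E \<Longrightarrow> a i i = 1"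
    and ex: "\<And>x. x \<in> X \<Longrightarrow> (\<Sum>i\<in>E. a x i *\<^sub>R i) = x"
    using unit_expansion[of S] S(1) by blast
  define C where "C = (\<Sum>i\<in>E. \<Sum>j\<in>E. \<bar>b i j\<bar>)"
  have "C \<ge> 0" by (auto simp: C_def intro: sum_nonneg)
  have bound: "\<bar>b x y\<bar> \<le> C * sqrt (a x x) * sqrt (a y y)" if xy: "x \<in> X" "y \<in> X" for x y
  proof -
    have "b x y = b (\<Sum>i\<in>E. a x i *\<^sub>R i) y" using ex[OF xy(1)] by simp
    also have "\<dots> = (\<Sum>i\<in>E. a x i *\<^sub>R b i y)"
      using b xy E X by (intro linear_map_on_sum[where X = X]) (auto simp: bilinear_on_def)
    also have "\<dots> = (\<Sum>i\<in>E. a x i *\<^sub>R (\<Sum>j\<in>E. a y j *\<^sub>R b i j))"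
    proof (intro sum.cong refl)
      fix i assume "i \<in> E"
      then have "b i (\<Sum>j\<in>E. a y j *\<^sub>R j) = (\<Sum>j\<in>E. a y j *\<^sub>R b i j)"
        using b E X by (intro linear_map_on_sum[where X = X]) (auto simp: bilinear_on_def)
      then show "a x i *\<^sub>R b i y = a x i *\<^sub>R (\<Sum>j\<in>E. a y j *\<^sub>R b i j)"
        using ex[OF xy(2)] by simp
    qed
    finally have "\<bar>b x y\<bar> = \<bar>\<Sum>i\<in>E. \<Sum>j\<in>E. a x i * (a y j * b i j)\<bar>"
      by (simp add: sum_distrib_left)
    also have "\<dots> \<le> (\<Sum>i\<in>E. \<Sum>j\<in>E. \<bar>a x i * (a y j * b i j)\<bar>)"
      by (rule order_trans[OF sum_abs sum_mono[OF sum_abs]])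
    also have "\<dots> \<le> (\<Sum>i\<in>E. \<Sum>j\<in>E. \<bar>b i j\<bar> * sqrt (a x x) * sqrt (a y y))"
    proof (intro sum_mono)
      fix i j assume "i \<in> E" "j \<in> E"
      then have "\<bar>a x i\<bar> * \<bar>a y j\<bar> \<le> sqrt (a x x) * sqrt (a y y)"
        using xy E nonneg by (intro mult_mono abs_le_of_unit) auto
      from mult_left_mono[OF this, of "\<bar>b i j\<bar>"]
      show "\<bar>a x i * (a y j * b i j)\<bar> \<le> \<bar>b i j\<bar> * sqrt (a x x) * sqrt (a y y)"
        by (simp add: abs_mult mult_ac)
    qed
    finally show ?thesis by (simp add: C_def sum_distrib_right)
  qed
  show thesis
  \<comment> \<open>\<open>C\<close> vanishes when \<open>b\<close> does, while the coercivity
    argument cancels the constant; adding 1 makes it positive.\<close>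
  proof (rule that[of "C + 1"])
    fix x y assume xy: "x \<in> X" "y \<in> X"
    have "C * (sqrt (a x x) * sqrt (a y y)) \<le> (C + 1) * (sqrt (a x x) * sqrt (a y y))"
      using nonneg xy by (intro mult_right_mono) auto
    then show "\<bar>b x y\<bar> \<le> (C + 1) * sqrt (a x x) * sqrt (a y y)"
      using bound[OF xy] by (simp add: mult.assoc)
  qed (use \<open>C \<ge> 0\<close> in simp)
qed

lemma bounded_linear_maps_to_dual:
  assumes b: "bilinear_on X b" and fin: "finite B" "X \<subseteq> span B"
    and N: "\<And>x. x \<in> X \<Longrightarrow> N x = sqrt (a x x)"
  shows "b \<in> bounded_linear_maps_to_dual X N X N"
proof -
  obtain C where C: "\<And>x y. \<lbrakk>x \<in> X; y \<in> X\<rbrakk> \<Longrightarrow> \<bar>b x y\<bar> \<le> C * N x * N y"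
    using bilinear_bound[OF b fin] N by (metis (no_types, lifting))
  have "b x \<in> dual_space X N" if "x \<in> X" for x
    using b that C unfolding dual_space_def bounded_linear_maps_def bilinear_on_def
    by (auto intro!: exI[of _ "C * N x"])
  then show ?thesis
    using b C unfolding bounded_linear_maps_to_dual_def bilinear_on_def by blast
qed

end

lemma inner_product_onI:
  fixes a :: "'a::real_vector \<Rightarrow> 'a \<Rightarrow> real"
  assumes X: "subspace X"
    and "\<And>x y z. \<lbrakk>x \<in> X; y \<in> X; z \<in> X\<rbrakk> \<Longrightarrow> a (x + y) z = a x z + a y z"
    and "\<And>c x z. \<lbrakk>x \<in> X; z \<in> X\<rbrakk> \<Longrightarrow> a (c *\<^sub>R x) z = c * a x z"
    and "\<And>x y. a x y = a y x"
    and "\<And>x. x \<in> X \<Longrightarrow> a x x \<ge> 0"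
    and "\<And>x. \<lbrakk>x \<in> X; a x x = 0\<rbrakk> \<Longrightarrow> x = 0"
  shows "inner_product_on X a"
proof
  show "bilinear_on X a" by (rule bilinear_onI_sym) (use assms in blast)+
qed (use assms in blast)+

text \<open>Orthogonal sum: it assembles the velocity and pressure forms on \<open>Xh\<close>, both
  for the product norm and for the diagonal of the Stokes operator.\<close>

lemma inner_product_on_Times:
  assumes "inner_product_on X a" "inner_product_on Y b"
  shows "inner_product_on (X \<times> Y) (\<lambda>(x, y) (x', y'). a x x' + b y y')"
proof -
  interpret a: inner_product_on X a by fact
  interpret b: inner_product_on Y b by fact
  show ?thesis
  proof
    show "subspace (X \<times> Y)" using a.X b.X by (rule subspace_Times)
    show "bilinear_on (X \<times> Y) (\<lambda>(x, y) (x', y'). a x x' + b y y')"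
      unfolding bilinear_on_def linear_map_on_def
      by (auto simp: a.add_left a.add_right b.add_left b.add_right
          a.scale_left a.scale_right b.scale_left b.scale_right distrib_left)
  next
    fix z assume z: "z \<in> X \<times> Y" "(\<lambda>(x, y) (x', y'). a x x' + b y y') z z = 0"
    then obtain x y where xy: "z = (x, y)" "x \<in> X" "y \<in> Y" "a x x + b y y = 0" by auto
    then have "a x x = 0" "b y y = 0" using a.nonneg[of x] b.nonneg[of y] by auto
    then show "z = 0" using xy a.definite b.definite by (simp add: zero_prod_def)
  qed (auto simp: a.sym b.sym intro: add_nonneg_nonneg a.nonneg b.nonneg)
qed

lemma finite_span_Times:
  fixes X :: "'a::real_vector set" and Y :: "'b::real_vector set"
  assumes "\<exists>B. finite B \<and> X \<subseteq> span B" "\<exists>C. finite C \<and> Y \<subseteq> span C"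
  shows "\<exists>D. finite D \<and> X \<times> Y \<subseteq> span D"
proof -
  obtain B C where BC: "finite B" "X \<subseteq> span B" "finite C" "Y \<subseteq> span C" using assms by blast
  define D where "D = (\<lambda>x. (x, 0)) ` B \<union> (\<lambda>y. (0, y)) ` C"
  have lin: "linear (\<lambda>x::'a. (x, 0::'b))" "linear (\<lambda>y::'b. (0::'a, y))"
    by (auto intro!: linearI)
  have "(x, y) \<in> span D" if "x \<in> X" "y \<in> Y" for x y
  proof -
    have "(x, 0::'b) \<in> span ((\<lambda>x. (x, 0)) ` B)" "(0::'a, y) \<in> span ((\<lambda>y. (0, y)) ` C)"
      unfolding linear_span_image[OF lin(1)] linear_span_image[OF lin(2)] using that BC by blast+
    then have "(x, 0) + (0, y) \<in> span D"
      unfolding D_def by (intro span_add) (auto intro: subsetD[OF span_mono])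
    then show ?thesis by simp
  qed
  then show ?thesis using BC by (intro exI[of _ D]) (auto simp: D_def)
qed

text \<open>With \<open>\<Phi> = id\<close>: on a finite-dimensional space a positive definite form dominates the square of
  any Euclidean norm.\<close>

lemma linearly_mapped_coercive_of_definite:
  assumes a: "inner_product_on X a" and s: "inner_product_on X s"
    and fin: "finite B" "X \<subseteq> span B"
    and N: "\<And>x. x \<in> X \<Longrightarrow> N x = sqrt (a x x)"
    and diag: "\<And>x. x \<in> X \<Longrightarrow> b x x = s x x"
    and dual: "b ` X \<subseteq> dual_space X N"
  shows "linearly_mapped_coercive X N X N b"
proof -
  interpret a: inner_product_on X a by (fact a)
  interpret s: inner_product_on X s by (fact s)
  \<comment> \<open>The definite form \<open>s\<close> is the measuring inner product here and the
    norm form \<open>a\<close> is the one being bounded.\<close>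
  obtain C where C: "C > 0"
    "\<And>x y. \<lbrakk>x \<in> X; y \<in> X\<rbrakk> \<Longrightarrow> \<bar>a x y\<bar> \<le> C * sqrt (s x x) * sqrt (s y y)"
    using s.bilinear_bound[OF a.bil fin] by blast
  have coer: "(N x)\<^sup>2 \<le> C * b x x" if "x \<in> X" for x
    using C(2)[OF that that] that a.nonneg s.nonneg
    by (simp add: N diag mult.assoc)
  let ?F = "inf (filtercomap N at_top) (principal X)"
  have "ereal r \<le> Liminf ?F (\<lambda>x. ereal (b x x / N x))" for r
  proof (rule Liminf_bounded)
    \<comment> \<open>The 1 makes the divisor \<open>N x\<close> positive; \<open>C * r\<close>
      gives \<open>C * r * N x \<le> (N x)\<^sup>2 \<le> C * b x x\<close>, from which
      \<open>C\<close> cancels.\<close>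
    have "\<forall>\<^sub>F x in filtercomap N at_top. N x \<ge> max 1 (C * r)"
      by (intro eventually_filtercomapI eventually_ge_at_top)
    then show "\<forall>\<^sub>F x in ?F. ereal r \<le> ereal (b x x / N x)"
      unfolding eventually_inf_principal
    proof (rule eventually_mono, intro impI)
      fix x assume x: "N x \<ge> max 1 (C * r)" "x \<in> X"
      then have "C * r * N x \<le> N x * N x" by (intro mult_right_mono) auto
      also have "\<dots> \<le> C * b x x" using coer[OF x(2)] by (simp add: power2_eq_square)
      finally have "r * N x \<le> b x x" using C(1) by (simp add: mult.assoc)
      then show "ereal r \<le> ereal (b x x / N x)" using x(1) by (simp add: le_divide_eq)
    qed
  qed
  then have "Liminf ?F (\<lambda>x. ereal (b x x / N x)) = \<infinity>"
    by (intro ereal_top) auto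
  moreover have "id \<in> bounded_linear_maps X N X N"
    by (auto simp: bounded_linear_maps_def linear_map_on_def intro: exI[of _ 1])
  ultimately show ?thesis
    using dual unfolding linearly_mapped_coercive_def by (intro conjI bexI[of _ id]) auto
qed


section \<open>Piecewise linear functions and nodal interpolation\<close>

text \<open>Two affine maps agree on a convex set, so agreement at the vertices spreads to the hull.
  This gives uniqueness of interpolants, matching across shared faces and constancy on an
  element.\<close>

lemma affine_eq_on_convex_hull:
  fixes f g :: "'a::real_vector \<Rightarrow> 'b::real_vector"
  assumes f: "linear L" "\<And>x. x \<in> convex hull S \<Longrightarrow> f x = a + L x"
    and g: "linear M" "\<And>x. x \<in> convex hull S \<Longrightarrow> g x = b + M x"
    and eq: "\<And>v. v \<in> S \<Longrightarrow> f v = g v"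
    and x: "x \<in> convex hull S"
  shows "f x = g x"
proof -
  have "convex {x. a + L x = b + M x}"
  proof (rule convexI)
    fix x y and u v :: real
    assume *: "x \<in> {x. a + L x = b + M x}" "y \<in> {x. a + L x = b + M x}" "u + v = 1"
    have "c + N (u *\<^sub>R x + v *\<^sub>R y) = u *\<^sub>R (c + N x) + v *\<^sub>R (c + N y)" if "linear N" for c N
    proof -
      have "c = u *\<^sub>R c + v *\<^sub>R c" using *(3) by (simp flip: scaleR_add_left)
      then show ?thesis
        using that by (simp add: linear_add linear_scale algebra_simps)
    qed
    from this[OF f(1), of a] this[OF g(1), of b]
    show "u *\<^sub>R x + v *\<^sub>R y \<in> {x. a + L x = b + M x}" using * by simp
  qed
  moreover have "S \<subseteq> {x. a + L x = b + M x}"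
    using eq f(2) g(2) hull_subset[of S convex] by fastforce
  ultimately have "x \<in> {x. a + L x = b + M x}" using x hull_minimal by blast
  then show ?thesis using f(2)[OF x] g(2)[OF x] by simp
qed

text \<open>Translating one vertex to the origin turns affine independence into linear independence,
  and a linear map with prescribed values there exists.\<close>

lemma affine_interpolation:
  fixes f :: "'a::euclidean_space \<Rightarrow> 'b::real_vector"
  assumes "\<not> affine_dependent C"
  shows "\<exists>a L. linear L \<and> (\<forall>v\<in>C. f v = a + L v)"
proof (cases "C = {}")
  case True
  then show ?thesis using linear_zero by auto
next
  case False
  then obtain c where c: "c \<in> C" by blast
  define D where "D = (\<lambda>x. - c + x) ` (C - {c})"
  have "independent D"
    using assms affine_dependent_iff_dependent2[OF c] by (simp add: D_def)
  from linear_independent_extend[OF this, of "\<lambda>y. f (c + y) - f c"]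
  obtain L where L: "linear L" "\<And>y. y \<in> D \<Longrightarrow> L y = f (c + y) - f c" by blast
  have "f v = (f c - L c) + L v" if v: "v \<in> C" for v
  proof (cases "v = c")
    case False
    then have "L (- c + v) = f v - f c" using v L(2)[of "- c + v"] by (simp add: D_def)
    then show ?thesis using L(1) by (simp add: linear_diff algebra_simps)
  qed simp
  then show ?thesis using L(1) by blast
qed

text \<open>Convexity of the square, in a form that lets an inequality checked at vertices spread
  over an element.\<close>

lemma convex_square_le_affine:
  fixes L M :: "'a::real_vector \<Rightarrow> real"
  assumes "linear L" "linear M"
  shows "convex {x. (a + L x)\<^sup>2 \<le> b + M x}"
proof (rule convexI)
  fix x y and u v :: real
  assume *: "x \<in> {x. (a + L x)\<^sup>2 \<le> b + M x}" "y \<in> {x. (a + L x)\<^sup>2 \<le> b + M x}"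
    "0 \<le> u" "0 \<le> v" "u + v = 1"
  have v: "v = 1 - u" using * by simp
  have comb: "c + N (u *\<^sub>R x + v *\<^sub>R y) = u * (c + N x) + v * (c + N y)"
    if "linear N" for c and N :: "'a \<Rightarrow> real"
    unfolding v using that by (simp only: linear_add linear_scale) (simp add: algebra_simps)
  define A B where "A = a + L x" and "B = a + L y"
  \<comment> \<open>The term \<open>u * v * (A - B)\<^sup>2\<close> is the exact convexity defect of
    the square.\<close>
  have "(u * A + v * B)\<^sup>2 = u * A\<^sup>2 + v * B\<^sup>2 - u * v * (A - B)\<^sup>2"
    unfolding v by (simp add: power2_eq_square algebra_simps)
  also have "\<dots> \<le> u * A\<^sup>2 + v * B\<^sup>2" using *(3,4) by simp
  also have "\<dots> \<le> u * (b + M x) + v * (b + M y)"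
    using * by (intro add_mono mult_left_mono) (auto simp: A_def B_def)
  finally show "u *\<^sub>R x + v *\<^sub>R y \<in> {x. (a + L x)\<^sup>2 \<le> b + M x}"
    by (simp add: comb[OF assms(1)] comb[OF assms(2)] A_def B_def)
qed

lemma sum_fun_apply: "(\<Sum>i\<in>A. f i) x = (\<Sum>i\<in>A. f i x)"
  by (induction A rule: infinite_finite_induct) simp_all

lemma scaleR_fun_apply [simp]: "(c *\<^sub>R f) x = c *\<^sub>R f x"
  by (simp add: scaleR_fun_def)

lemma P1_cases:
  assumes "f \<in> P1 \<T>" "K \<in> \<T>"
  obtains a L where "linear L" "\<And>x. x \<in> K \<Longrightarrow> f x = a + L x"
  using assms unfolding P1_def by blast

lemma P1_continuous: "f \<in> P1 \<T> \<Longrightarrow> continuous_on (\<Union>\<T>) f"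
  and P1_outside: "f \<in> P1 \<T> \<Longrightarrow> x \<notin> \<Union>\<T> \<Longrightarrow> f x = 0"
  by (auto simp: P1_def)

lemma subspace_P1: "subspace (P1 \<T> :: ('a::euclidean_space \<Rightarrow> 'b::real_normed_vector) set)"
proof (rule subspaceI)
  show "0 \<in> P1 \<T>"
    unfolding P1_def
    by (auto intro!: exI[of _ 0] exI[of _ "\<lambda>x. 0"] linear_zero)
next
  fix f g :: "'a \<Rightarrow> 'b" assume fg: "f \<in> P1 \<T>" "g \<in> P1 \<T>"
  have "\<exists>a L. linear L \<and> (\<forall>x\<in>K. (f + g) x = a + L x)" if K: "K \<in> \<T>" for K
  proof -
    obtain a L where L: "linear L" "\<And>x. x \<in> K \<Longrightarrow> f x = a + L x"
      using P1_cases[OF fg(1) K] by blast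
    obtain b M where M: "linear M" "\<And>x. x \<in> K \<Longrightarrow> g x = b + M x"
      using P1_cases[OF fg(2) K] by blast
    show ?thesis using L M
      by (intro exI[of _ "a + b"] exI[of _ "\<lambda>x. L x + M x"]) (auto intro: linear_compose_add)
  qed
  moreover have "continuous_on (\<Union>\<T>) (f + g)"
    using fg by (auto simp: plus_fun_def intro: continuous_on_add P1_continuous)
  moreover have "(f + g) x = 0" if "x \<notin> \<Union>\<T>" for x
    using P1_outside[OF fg(1) that] P1_outside[OF fg(2) that] by simp
  ultimately show "f + g \<in> P1 \<T>"
    unfolding P1_def by blast
next
  fix c and f :: "'a \<Rightarrow> 'b" assume f: "f \<in> P1 \<T>"
  have "\<exists>a L. linear L \<and> (\<forall>x\<in>K. (c *\<^sub>R f) x = a + L x)" if K: "K \<in> \<T>" for K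
  proof -
    obtain a L where "linear L" "\<And>x. x \<in> K \<Longrightarrow> f x = a + L x"
      using P1_cases[OF f K] by blast
    then show ?thesis
      by (intro exI[of _ "c *\<^sub>R a"] exI[of _ "\<lambda>x. c *\<^sub>R L x"])
        (auto intro: linear_compose_scale_right simp: scaleR_add_right)
  qed
  moreover have "continuous_on (\<Union>\<T>) (c *\<^sub>R f)"
    using f by (auto simp: scaleR_fun_def intro: continuous_on_scaleR continuous_on_const P1_continuous)
  moreover have "(c *\<^sub>R f) x = 0" if "x \<notin> \<Union>\<T>" for x
    using P1_outside[OF f that] by simp
  ultimately show "c *\<^sub>R f \<in> P1 \<T>"
    unfolding P1_def by blast
qed

section \<open>Elements of a conforming mesh and unisolvence of nodal values\<close>

locale mesh =
  fixes \<T> :: "'a::euclidean_space set set"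
  assumes triangulation: "triangulation \<T>"
    and full_dim: "K \<in> \<T> \<Longrightarrow> int DIM('a) simplex K"
begin

lemma finite_mesh: "finite \<T>"
  using triangulation by (simp add: triangulation_def)

lemma cell:
  assumes "K \<in> \<T>"
  shows "convex K" "compact K" "interior K \<noteq> {}"
    "finite {v. v extreme_point_of K}" "\<not> affine_dependent {v. v extreme_point_of K}"
    "convex hull {v. v extreme_point_of K} = K"
proof -
  obtain C where C: "\<not> affine_dependent C" "int (card C) = int DIM('a) + 1" "K = convex hull C"
    using full_dim[OF assms] unfolding simplex_def by blast
  have ext: "{v. v extreme_point_of K} = C"
    using extreme_point_of_convex_hull_affine_independent[OF C(1)] C(3) by auto
  show "finite {v. v extreme_point_of K}" "\<not> affine_dependent {v. v extreme_point_of K}"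
    "convex hull {v. v extreme_point_of K} = K"
    using C ext aff_independent_finite by auto
  show cc: "convex K" "compact K"
    using full_dim[OF assms] convex_simplex compact_simplex by blast+
  \<comment> \<open>Full affine dimension identifies interior and relative interior, and the latter
    is nonempty for a nonempty convex set.\<close>
  have "aff_dim K = int DIM('a)"
    using C aff_dim_affine_independent[OF C(1)] by (simp add: aff_dim_convex_hull)
  then show "interior K \<noteq> {}"
    using cc(1) by (metis aff_dim_empty aff_dim_eq_full interior_rel_interior_gen
        of_nat_0_le_iff rel_interior_eq_empty not_one_le_zero neg_0_le_iff_le)
qed

text \<open>By conformity the intersection is a face of both elements, so its extreme points are the
  common vertices, and Krein-Milman recovers it from them. Hence nodal values determine an affine
  function on a shared face.\<close>

lemma cell_Int:
  assumes "K \<in> \<T>" "K' \<in> \<T>"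
  shows "K \<inter> K' = convex hull {v. v extreme_point_of K \<and> v extreme_point_of K'}"
proof -
  have "K \<inter> K' face_of K" "K' \<inter> K face_of K'"
    using triangulation assms by (simp_all add: triangulation_def)
  then have face: "K \<inter> K' face_of K" "K \<inter> K' face_of K'" by (simp_all add: Int_commute)
  have "v extreme_point_of (K \<inter> K') \<longleftrightarrow> v extreme_point_of K \<and> v extreme_point_of K'" for v
    using extreme_point_of_face[OF face(1), of v] extreme_point_of_face[OF face(2), of v]
    by (auto simp: extreme_point_of_def)
  then show ?thesis
    using Krein_Milman_Minkowski[of "K \<inter> K'"] cell(1,2)[OF assms(1)] cell(1,2)[OF assms(2)]
    by (simp add: convex_Int compact_Int)
qed

lemma finite_mesh_nodes: "finite (mesh_nodes \<T>)"
proof -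
  have "mesh_nodes \<T> = (\<Union>K\<in>\<T>. {v. v extreme_point_of K})" by (auto simp: mesh_nodes_def)
  then show ?thesis using finite_mesh cell(4) by simp
qed

lemma P1_eqI:
  fixes f g :: "'a \<Rightarrow> 'b::real_normed_vector"
  assumes fg: "f \<in> P1 \<T>" "g \<in> P1 \<T>" and eq: "\<And>v. v \<in> mesh_nodes \<T> \<Longrightarrow> f v = g v"
  shows "f = g"
proof
  fix x
  show "f x = g x"
  proof (cases "x \<in> \<Union>\<T>")
    case True
    then obtain K where K: "K \<in> \<T>" "x \<in> K" by blast
    obtain a L where L: "linear L" "\<And>x. x \<in> K \<Longrightarrow> f x = a + L x"
      using P1_cases[OF fg(1) K(1)] by blast
    obtain b M where M: "linear M" "\<And>x. x \<in> K \<Longrightarrow> g x = b + M x"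
      using P1_cases[OF fg(2) K(1)] by blast
    have "f v = g v" if "v extreme_point_of K" for v
      using eq that K(1) by (auto simp: mesh_nodes_def)
    then show ?thesis
      using affine_eq_on_convex_hull[of L "{v. v extreme_point_of K}" f a M g b x]
        cell(6)[OF K(1)] K(2) L M by auto
  qed (use fg P1_outside in metis)
qed

text \<open>Affine interpolation on each element. Two local pieces agree at the common vertices,
  hence on the whole intersection by \<open>cell_Int\<close>, and gluing over finitely many closed
  sets preserves continuity.\<close>

lemma P1_interpolant_exists:
  fixes f :: "'a \<Rightarrow> 'b::real_normed_vector"
  shows "\<exists>g\<in>P1 \<T>. \<forall>v\<in>mesh_nodes \<T>. g v = f v"
proof -
  have "\<forall>K\<in>\<T>. \<exists>a L. linear L \<and> (\<forall>v. v extreme_point_of K \<longrightarrow> f v = a + L v)"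
    using affine_interpolation[OF cell(5), of _ f] by fastforce
  then obtain a L where aL: "\<And>K. K \<in> \<T> \<Longrightarrow> linear (L K)"
      "\<And>K v. \<lbrakk>K \<in> \<T>; v extreme_point_of K\<rbrakk> \<Longrightarrow> f v = a K + L K v"
    by metis
  have agree: "a K + L K x = a K' + L K' x" if "K \<in> \<T>" "K' \<in> \<T>" "x \<in> K" "x \<in> K'" for K K' x
  proof (rule affine_eq_on_convex_hull[of "L K" "{v. v extreme_point_of K \<and> v extreme_point_of K'}"
        "\<lambda>x. a K + L K x" "a K" "L K'" "\<lambda>x. a K' + L K' x" "a K'"])
    fix v assume "v \<in> {v. v extreme_point_of K \<and> v extreme_point_of K'}"
    then show "a K + L K v = a K' + L K' v" using aL(2) that by (metis mem_Collect_eq)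
  qed (use that aL(1) cell_Int in auto)
  \<comment> \<open>The element containing \<open>x\<close> is chosen arbitrarily;
    \<open>agree\<close> makes the value independent of the choice.\<close>
  define g where
    "g x = (if x \<in> \<Union>\<T> then let K = SOME K. K \<in> \<T> \<and> x \<in> K in a K + L K x else 0)" for x
  have g: "g x = a K + L K x" if K: "K \<in> \<T>" "x \<in> K" for K x
  proof -
    define K' where "K' = (SOME K. K \<in> \<T> \<and> x \<in> K)"
    have "K' \<in> \<T> \<and> x \<in> K'"
      unfolding K'_def by (rule someI[of _ K]) (use K in simp)
    then have "a K' + L K' x = a K + L K x" using agree[of K' K x] K by blast
    moreover have "g x = a K' + L K' x" using K unfolding g_def Let_def K'_def by auto
    ultimately show ?thesis by simp
  qed
  have "continuous_on (\<Union>K\<in>\<T>. K) g"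
  proof (rule continuous_on_closed_Union[OF finite_mesh])
    fix K assume K: "K \<in> \<T>"
    then show "closed K" using cell(2) compact_imp_closed by blast
    have "continuous_on K (\<lambda>x. a K + L K x)"
      using aL(1)[OF K] by (intro continuous_intros linear_continuous_on) (simp add: linear_conv_bounded_linear)
    then show "continuous_on K g" using g[OF K] by (metis (no_types, lifting) continuous_on_cong)
  qed
  then have "continuous_on (\<Union>\<T>) g" by simp
  moreover have "\<exists>a L. linear L \<and> (\<forall>x\<in>K. g x = a + L x)" if "K \<in> \<T>" for K
    using g[OF that] aL(1)[OF that] by blast
  moreover have "g x = 0" if "x \<notin> \<Union>\<T>" for x using that by (simp add: g_def)
  ultimately have "g \<in> P1 \<T>" unfolding P1_def by blast
  moreover have "g v = f v" if v: "v \<in> mesh_nodes \<T>" for v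
  proof -
    obtain K where K: "K \<in> \<T>" "v extreme_point_of K" using v by (auto simp: mesh_nodes_def)
    then show ?thesis using g[OF K(1)] aL(2)[OF K] by (simp add: extreme_point_of_def)
  qed
  ultimately show ?thesis by blast
qed

text \<open>Unisolvence gives the definite description a meaning for arbitrary nodal data, including
  the discontinuous data that define hat functions below.\<close>

lemma lagrange_interp: "lagrange_interp \<T> f \<in> P1 \<T>"
  and lagrange_interp_node: "v \<in> mesh_nodes \<T> \<Longrightarrow> lagrange_interp \<T> f v = f v"
proof -
  have "\<exists>!g. g \<in> P1 \<T> \<and> (\<forall>v\<in>mesh_nodes \<T>. g v = f v)"
    using P1_interpolant_exists[of f] P1_eqI by (metis (no_types, lifting))
  from theI'[OF this]
  show "lagrange_interp \<T> f \<in> P1 \<T>" "v \<in> mesh_nodes \<T> \<Longrightarrow> lagrange_interp \<T> f v = f v"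
    unfolding lagrange_interp_def by auto
qed

lemma lagrange_interp_eqI:
  "\<lbrakk>g \<in> P1 \<T>; \<And>v. v \<in> mesh_nodes \<T> \<Longrightarrow> g v = f v\<rbrakk> \<Longrightarrow> lagrange_interp \<T> f = g"
  by (rule P1_eqI) (auto simp: lagrange_interp lagrange_interp_node)

text \<open>The generators are the nodal hat functions times the standard basis vectors of the
  range.\<close>

lemma P1_finite_span:
  "\<exists>B. finite B \<and> (P1 \<T> :: ('a \<Rightarrow> 'b::euclidean_space) set) \<subseteq> span B"
proof -
  define \<phi> where "\<phi> v = lagrange_interp \<T> (\<lambda>y. if y = v then 1 else 0)" for v
  define h :: "'a \<Rightarrow> 'b \<Rightarrow> 'a \<Rightarrow> 'b" where "h v b = (\<lambda>x. \<phi> v x *\<^sub>R b)" for v b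
  define B where "B = (\<lambda>(v, b). h v b) ` (mesh_nodes \<T> \<times> Basis)"
  have h: "h v b \<in> P1 \<T>" for v b
  proof -
    have \<phi>: "\<phi> v \<in> P1 \<T>" by (simp add: \<phi>_def lagrange_interp)
    have "\<exists>a L. linear L \<and> (\<forall>x\<in>K. h v b x = a + L x)" if K: "K \<in> \<T>" for K
    proof -
      obtain a L where L: "linear L" "\<And>x. x \<in> K \<Longrightarrow> \<phi> v x = a + L x"
        using P1_cases[OF \<phi> K] by blast
      have "linear (\<lambda>x. L x *\<^sub>R b)"
        using linear_compose[OF L(1) bounded_linear.linear[OF bounded_linear_scaleR_left]]
        by (simp add: o_def)
      then show ?thesis using L(2)
        by (intro exI[of _ "a *\<^sub>R b"] exI[of _ "\<lambda>x. L x *\<^sub>R b"])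
          (auto simp: h_def scaleR_add_left)
    qed
    moreover have "continuous_on (\<Union>\<T>) (h v b)"
      unfolding h_def by (intro continuous_intros P1_continuous[OF \<phi>])
    ultimately show ?thesis
      using P1_outside[OF \<phi>] unfolding P1_def by (auto simp: h_def)
  qed
  have "f \<in> span B" if f: "f \<in> P1 \<T>" for f
  proof -
    define g where "g = (\<Sum>v\<in>mesh_nodes \<T>. \<Sum>b\<in>Basis. (f v \<bullet> b) *\<^sub>R h v b)"
    have "g \<in> P1 \<T>"
      unfolding g_def using subspace_P1 h by (intro subspace_sum subspace_scale) auto
    moreover have "f w = g w" if w: "w \<in> mesh_nodes \<T>" for w
    proof -
      have "g w = (\<Sum>v\<in>mesh_nodes \<T>. if v = w then \<Sum>b\<in>Basis. (f v \<bullet> b) *\<^sub>R b else 0)"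
        unfolding g_def sum_fun_apply
        by (intro sum.cong refl) (auto simp: h_def \<phi>_def lagrange_interp_node[OF w])
      then show ?thesis
        using w finite_mesh_nodes by (simp add: euclidean_representation)
    qed
    ultimately have "f = g" using f by (intro P1_eqI)
    moreover have "g \<in> span B"
      unfolding g_def by (intro span_sum span_scale span_base) (auto simp: B_def)
    ultimately show "f \<in> span B" by simp
  qed
  moreover have "finite B" using finite_mesh_nodes by (simp add: B_def)
  ultimately show ?thesis by blast
qed

text \<open>The image of the mesh is finite and connected, hence at most a single point; this
  replaces a walk through neighbouring elements.\<close>

lemma P1_constant:
  fixes f :: "'a \<Rightarrow> 'b::metric_space"
  assumes "\<And>K. K \<in> \<T> \<Longrightarrow> f constant_on K" "continuous_on (\<Union>\<T>) f" "connected (\<Union>\<T>)"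
  shows "f constant_on \<Union>\<T>"
proof -
  obtain c where c: "\<And>K x. \<lbrakk>K \<in> \<T>; x \<in> K\<rbrakk> \<Longrightarrow> f x = c K"
    using assms(1) unfolding constant_on_def by metis
  have "f ` \<Union>\<T> \<subseteq> c ` \<T>" using c by auto
  then have "finite (f ` \<Union>\<T>)" using finite_mesh finite_surj by blast
  moreover have "connected (f ` \<Union>\<T>)" using assms connected_continuous_image by blast
  ultimately show ?thesis
    using connected_finite_iff_sing[of "f ` \<Union>\<T>"] unfolding constant_on_def by auto
qed

text \<open>Both sides coincide at the vertices of an element, and the set where the inequality
  holds between the affine pieces is convex.\<close>

lemma square_le_lagrange_interp:
  assumes p: "p \<in> P1 \<T>" and x: "x \<in> \<Union>\<T>"
  shows "(p x)\<^sup>2 \<le> lagrange_interp \<T> (\<lambda>y. (p y)\<^sup>2) x"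
proof -
  let ?I = "lagrange_interp \<T> (\<lambda>y. (p y)\<^sup>2)"
  obtain K where K: "K \<in> \<T>" "x \<in> K" using x by blast
  obtain a L where L: "linear L" "\<And>x. x \<in> K \<Longrightarrow> p x = a + L x" using P1_cases[OF p K(1)] by blast
  obtain b M where M: "linear M" "\<And>x. x \<in> K \<Longrightarrow> ?I x = b + M x"
    using P1_cases[OF lagrange_interp K(1)] by metis
  have "v \<in> {x. (a + L x)\<^sup>2 \<le> b + M x}" if v: "v extreme_point_of K" for v
  proof -
    have "?I v = (p v)\<^sup>2" using lagrange_interp_node[of v] v K by (auto simp: mesh_nodes_def)
    moreover have "v \<in> K" using v by (simp add: extreme_point_of_def)
    ultimately show ?thesis using L M by simp
  qed
  then have "convex hull {v. v extreme_point_of K} \<subseteq> {x. (a + L x)\<^sup>2 \<le> b + M x}"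
    using convex_square_le_affine[OF L(1) M(1)] by (intro hull_minimal) auto
  then show ?thesis using K L M cell(6)[OF K(1)] by auto
qed

text \<open>At the midpoint of two vertices \<open>v\<close> and \<open>w\<close> the gap between
  interpolant and square is \<open>(p v - p w)\<^sup>2 / 4\<close>. So equality forces equal vertex
  values, and an affine function with equal vertex values is constant.\<close>

lemma constant_on_of_square_eq_lagrange_interp:
  fixes p :: "'a \<Rightarrow> real"
  assumes p: "p \<in> P1 \<T>" and K: "K \<in> \<T>"
    and eq: "\<And>x. x \<in> K \<Longrightarrow> (p x)\<^sup>2 = lagrange_interp \<T> (\<lambda>y. (p y)\<^sup>2) x"
  shows "p constant_on K"
proof -
  let ?I = "lagrange_interp \<T> (\<lambda>y. (p y)\<^sup>2)"
  obtain a L where L: "linear L" "\<And>x. x \<in> K \<Longrightarrow> p x = a + L x" using P1_cases[OF p K] by blast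
  obtain b M where M: "linear M" "\<And>x. x \<in> K \<Longrightarrow> ?I x = b + M x"
    using P1_cases[OF lagrange_interp K] by metis
  have ext: "p v = p w" if vw: "v extreme_point_of K" "w extreme_point_of K" for v w
  proof -
    define m where "m = (1/2) *\<^sub>R v + (1/2) *\<^sub>R w"
    have vwK: "v \<in> K" "w \<in> K" using vw by (auto simp: extreme_point_of_def)
    have mK: "m \<in> K" unfolding m_def using cell(1)[OF K] vwK by (intro convexD) auto
    have "p m = (p v + p w) / 2"
      using L(2)[OF mK] L(2)[OF vwK(1)] L(2)[OF vwK(2)] L(1)
      by (simp add: m_def linear_add linear_scale field_simps)
    moreover have "?I m = (?I v + ?I w) / 2"
      using M(2)[OF mK] M(2)[OF vwK(1)] M(2)[OF vwK(2)] M(1)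
      by (simp add: m_def linear_add linear_scale field_simps)
    moreover have "?I v = (p v)\<^sup>2" "?I w = (p w)\<^sup>2"
      using vw K by (auto simp: mesh_nodes_def intro!: lagrange_interp_node)
    ultimately have "((p v + p w) / 2)\<^sup>2 = ((p v)\<^sup>2 + (p w)\<^sup>2) / 2"
      using eq[OF mK] by metis
    then have "(p v - p w)\<^sup>2 = 0" by (simp add: power2_eq_square field_simps)
    then show ?thesis by simp
  qed
  obtain v where v: "v extreme_point_of K"
    using cell(3,6)[OF K] by (metis convex_hull_empty empty_Collect_eq interior_empty)
  have "p x = p v" if x: "x \<in> K" for x
  proof (rule affine_eq_on_convex_hull[of L "{v. v extreme_point_of K}" p a "\<lambda>x. 0" "\<lambda>x. p v" "p v" x])
    show "p w = p v" if "w \<in> {v. v extreme_point_of K}" for w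
      using that v by (intro ext) auto
  qed (use x L cell(6)[OF K] linear_zero in auto)
  then show ?thesis by (auto simp: constant_on_def)
qed

end


section \<open>Integrals over the domain\<close>

lemma jacobian_eqI:
  fixes f :: "real^'n \<Rightarrow> real^'m"
  assumes "(f has_derivative (*v) A) (at x)"
  shows "jacobian f (at x) = A"
  using frechet_derivative_at[OF assms] by (metis jacobian_def matrix_of_matrix_vector_mul)

text \<open>Makes the divergence a linear functional of the Jacobian, so its regularity and
  linearity are inherited.\<close>

lemma trace_eq_inner: "trace A = A \<bullet> mat 1" for A :: "real^'n^'n"
proof -
  have "(\<Sum>j\<in>UNIV. A $ i $ j * (if i = j then 1 else 0)) = A $ i $ i" for i
    by (simp add: if_distrib cong: if_cong)
  then show ?thesis by (simp add: trace_def inner_vec_def mat_def)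
qed

locale fem =
  fixes \<Omega> :: "(real^'d) set" and \<T> :: "(real^'d) set set"
  assumes domain: "polyhedral_domain \<Omega>" and mesh: "conforming_mesh \<Omega> \<T>"

sublocale fem \<subseteq> mesh \<T>
  using mesh by unfold_locales (auto simp: conforming_mesh_def)

context fem
begin

lemma Union_mesh: "\<Union>\<T> = closure \<Omega>"
  using mesh by (simp add: conforming_mesh_def)

lemma domain_facts: "open \<Omega>" "bounded \<Omega>" "connected \<Omega>" "\<Omega> \<noteq> {}"
  using domain by (auto simp: polyhedral_domain_def)

text \<open>An open subset of full measure on which the Jacobians of \<open>P\<^sub>1\<close> functions exist and are locally
  constant. The intersection with \<open>\<Omega>\<close> matters: the interior of an element lies in the closure of
  \<open>\<Omega>\<close> but may contain boundary points, for instance if \<open>\<Omega>\<close> is a slit domain.\<close>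

definition W :: "(real^'d) set" where
  "W = \<Omega> \<inter> (\<Union>K\<in>\<T>. interior K)"

lemma open_W: "open W" and bounded_W: "bounded W" and W_subset: "W \<subseteq> \<Omega>"
  using domain_facts by (auto simp: W_def bounded_Int)

lemma W_cell: "x \<in> W \<Longrightarrow> \<exists>K\<in>\<T>. x \<in> interior K"
  by (auto simp: W_def)

lemma W_lmeasurable: "W \<in> lmeasurable"
  using open_W bounded_W by (rule lmeasurable_open[rotated])

text \<open>A point of the domain outside all element interiors lies on the frontier of an element,
  and frontiers of convex sets are null.\<close>

lemma negligible_complement: "negligible (\<Omega> - W)"
proof (rule negligible_subset)
  show "negligible (\<Union>K\<in>\<T>. frontier K)"
    using finite_mesh cell(1) negligible_convex_frontier by blast
  show "\<Omega> - W \<subseteq> (\<Union>K\<in>\<T>. frontier K)"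
  proof
    fix x assume x: "x \<in> \<Omega> - W"
    then obtain K where K: "K \<in> \<T>" "x \<in> K" using Union_mesh closure_subset by blast
    then have "x \<in> frontier K"
      using x closure_subset unfolding frontier_def W_def by blast
    then show "x \<in> (\<Union>K\<in>\<T>. frontier K)" using K by blast
  qed
qed

text \<open>\<open>\<Omega> - closure W\<close> is open and null, hence empty. This density
  transports identities from \<open>W\<close> to whole elements.\<close>

lemma closure_W: "closure W = closure \<Omega>"
proof
  show "closure W \<subseteq> closure \<Omega>" using W_subset by (rule closure_mono)
  have "open (\<Omega> - closure W)" using domain_facts by (simp add: open_Diff)
  moreover have "negligible (\<Omega> - closure W)"
    using negligible_complement by (rule negligible_subset) (use closure_subset in blast)
  ultimately have "\<Omega> \<subseteq> closure W" using open_not_negligible by blast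
  then show "closure \<Omega> \<subseteq> closure W" by (simp add: closure_minimal)
qed

lemma cell_meets_W:
  assumes "K \<in> \<T>"
  obtains x where "x \<in> interior K" "x \<in> W"
proof -
  have "interior K \<subseteq> closure \<Omega>" using assms Union_mesh interior_subset by blast
  then have "interior K \<inter> \<Omega> \<noteq> {}"
    using cell(3)[OF assms] open_Int_closure_eq_empty[of "interior K" \<Omega>] by auto
  then show thesis using that assms unfolding W_def by blast
qed

text \<open>Boundedness and continuity on \<open>W\<close> give integrability and survive products;
  continuity also upgrades vanishing almost everywhere to vanishing on \<open>W\<close>. Values off
  \<open>W\<close> are left free, as Jacobians may be meaningless there.\<close>

definition regular :: "(real^'d \<Rightarrow> 'b::euclidean_space) \<Rightarrow> bool" where
  "regular f \<longleftrightarrow> continuous_on W f \<and> bounded (f ` W)"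

lemma regular_bilinear:
  assumes "bounded_bilinear B" "regular f" "regular g"
  shows "regular (\<lambda>x. B (f x) (g x))"
proof -
  interpret bounded_bilinear B by fact
  obtain K where K: "\<And>a b. norm (B a b) \<le> norm a * norm b * K" "K > 0" using pos_bounded by blast
  obtain C where C: "\<And>x. x \<in> W \<Longrightarrow> norm (f x) \<le> C"
    using assms unfolding regular_def bounded_iff by auto
  obtain D where D: "\<And>x. x \<in> W \<Longrightarrow> norm (g x) \<le> D"
    using assms unfolding regular_def bounded_iff by auto
  have "norm (B (f x) (g x)) \<le> C * D * K" if "x \<in> W" for x
  proof (rule order_trans[OF K(1)])
    have "norm (f x) * norm (g x) \<le> C * D"
      using C[OF that] D[OF that] by (intro mult_mono) (auto intro: order_trans[OF norm_ge_zero])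
    then show "norm (f x) * norm (g x) * K \<le> C * D * K" using K(2) by simp
  qed
  then show ?thesis
    using assms continuous_on[of W f g] unfolding regular_def bounded_iff by blast
qed

lemmas regular_mult = regular_bilinear[OF bounded_bilinear_mult]
lemmas regular_inner = regular_bilinear[OF bounded_bilinear_inner]

lemma regular_const: "regular (\<lambda>x. c)"
  by (auto simp: regular_def bounded_iff)

lemma regular_add: "\<lbrakk>regular f; regular g\<rbrakk> \<Longrightarrow> regular (\<lambda>x. f x + g x)"
  by (auto simp: regular_def intro!: continuous_on_add bounded_plus_comp)

lemma regular_diff: "\<lbrakk>regular f; regular g\<rbrakk> \<Longrightarrow> regular (\<lambda>x. f x - g x)"
  by (auto simp: regular_def intro!: continuous_on_diff bounded_minus_comp)

lemma regular_scale: "regular f \<Longrightarrow> regular (\<lambda>x. c * f x)" for f :: "real^'d \<Rightarrow> real"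
  by (rule regular_mult[OF regular_const])

lemma regular_P1: "f \<in> P1 \<T> \<Longrightarrow> regular f"
proof -
  assume f: "f \<in> P1 \<T>"
  have sub: "W \<subseteq> \<Union>\<T>" using W_subset Union_mesh closure_subset by blast
  have "compact (\<Union>\<T>)" using domain_facts Union_mesh by (simp add: compact_closure)
  then have "bounded (f ` \<Union>\<T>)"
    using P1_continuous[OF f] compact_continuous_image compact_imp_bounded by blast
  then show ?thesis
    using sub P1_continuous[OF f] unfolding regular_def
    by (meson bounded_subset continuous_on_subset image_mono)
qed

lemma regular_absolutely_integrable:
  assumes "regular f"
  shows "f absolutely_integrable_on W"
proof -
  obtain B where B: "\<And>x. x \<in> W \<Longrightarrow> norm (f x) \<le> B"
    using assms unfolding regular_def bounded_iff by auto
  have "W \<in> sets lebesgue" using W_lmeasurable by auto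
  then show ?thesis
    using assms B W_lmeasurable
    by (intro measurable_bounded_by_integrable_imp_absolutely_integrable[where g = "\<lambda>x. B"]
        continuous_imp_measurable_on_sets_lebesgue integrable_on_const) (auto simp: regular_def)
qed

lemma regular_integrable: "regular f \<Longrightarrow> f integrable_on W"
  using regular_absolutely_integrable absolutely_integrable_on_def by blast

lemma lint_eq_integral:
  assumes "regular f"
  shows "(LINT x:\<Omega>|lebesgue. f x) = integral W f"
proof -
  have neg: "negligible {x \<in> W - \<Omega>. f x \<noteq> 0}" "negligible {x \<in> \<Omega> - W. f x \<noteq> 0}"
  proof -
    have "{x \<in> W - \<Omega>. f x \<noteq> 0} = {}" using W_subset by blast
    then show "negligible {x \<in> W - \<Omega>. f x \<noteq> 0}" by (metis negligible_empty)
    show "negligible {x \<in> \<Omega> - W. f x \<noteq> 0}"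
      using negligible_complement by (rule negligible_subset) auto
  qed
  have "f absolutely_integrable_on \<Omega>"
    using regular_absolutely_integrable[OF assms] absolutely_integrable_spike_set_eq[OF neg] by blast
  then have "(LINT x:\<Omega>|lebesgue. f x) = integral \<Omega> f"
    by (rule set_lebesgue_integral_eq_integral)
  also have "\<dots> = integral W f"
    using neg by (rule integral_spike_set[rotated])
  finally show ?thesis .
qed

text \<open>The integrand \<open>h\<close> is kept separate because additivity of Jacobians is
  available only on \<open>W\<close>.\<close>

lemma lint_add:
  assumes "regular f" "regular g" "regular h" "\<And>x. x \<in> W \<Longrightarrow> h x = f x + g x"
  shows "(LINT x:\<Omega>|lebesgue. h x) = (LINT x:\<Omega>|lebesgue. f x) + (LINT x:\<Omega>|lebesgue. g x)"
proof -
  have "integral W h = integral W (\<lambda>x. f x + g x)" using assms(4) by (rule integral_cong)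
  then show ?thesis
    using assms(1-3)
    by (simp add: lint_eq_integral regular_integrable Henstock_Kurzweil_Integration.integral_add)
qed

lemma lint_scale:
  fixes f :: "real^'d \<Rightarrow> real"
  assumes "regular f" "regular h" "\<And>x. x \<in> W \<Longrightarrow> h x = c * f x"
  shows "(LINT x:\<Omega>|lebesgue. h x) = c * (LINT x:\<Omega>|lebesgue. f x)"
proof -
  have "integral W h = integral W (\<lambda>x. c * f x)" using assms(3) by (rule integral_cong)
  then show ?thesis
    using assms by (simp add: lint_eq_integral)
qed

lemma lint_diff:
  assumes "regular f" "regular g"
  shows "(LINT x:\<Omega>|lebesgue. f x - g x) = (LINT x:\<Omega>|lebesgue. f x) - (LINT x:\<Omega>|lebesgue. g x)"
  using assms
  by (simp add: lint_eq_integral regular_integrable regular_diff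
      Henstock_Kurzweil_Integration.integral_diff)

lemma lint_nonneg:
  fixes f :: "real^'d \<Rightarrow> real"
  assumes "regular f" "\<And>x. x \<in> W \<Longrightarrow> f x \<ge> 0"
  shows "(LINT x:\<Omega>|lebesgue. f x) \<ge> 0"
  using assms by (simp add: lint_eq_integral regular_integrable integral_nonneg)

text \<open>The points of \<open>W\<close> where \<open>f\<close> is nonzero form an open set, which
  is null because the integrand is nonnegative with zero integral; an open null set is
  empty.\<close>

lemma lint_eq_0:
  fixes f :: "real^'d \<Rightarrow> real"
  assumes f: "regular f" "\<And>x. x \<in> W \<Longrightarrow> f x \<ge> 0" and 0: "(LINT x:\<Omega>|lebesgue. f x) = 0"
    and x: "x \<in> W"
  shows "f x = 0"
proof -
  have int: "f absolutely_integrable_on W" using f(1) by (rule regular_absolutely_integrable)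
  have "(LINT x:W|lebesgue. f x) = 0"
    using 0 lint_eq_integral[OF f(1)] set_lebesgue_integral_eq_integral(2)[OF int] by simp
  moreover have "AE x in lebesgue. 0 \<le> indicat_real W x *\<^sub>R f x"
    using f(2) by (auto simp: indicator_def)
  ultimately have "AE x in lebesgue. indicat_real W x *\<^sub>R f x = 0"
    using int integral_nonneg_eq_0_iff_AE unfolding set_integrable_def set_lebesgue_integral_def
    by blast
  then have ae: "AE x in lebesgue. x \<notin> W \<inter> f -` (- {0})"
    by (rule eventually_mono) (auto simp: indicator_def)
  have "open (W \<inter> f -` (- {0}))"
    using f(1) open_W by (intro continuous_open_preimage) (auto simp: regular_def)
  moreover from this have "negligible (W \<inter> f -` (- {0}))"
    using ae AE_iff_null_sets[of "W \<inter> f -` (- {0})" lebesgue]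
    by (simp add: negligible_iff_null_sets borel_open)
  ultimately show ?thesis using x open_not_negligible by blast
qed

lemma P1_eq_on_W:
  assumes "f \<in> P1 \<T>" "g \<in> P1 \<T>" "\<And>x. x \<in> W \<Longrightarrow> f x = g x"
  shows "f = g"
proof
  fix x
  show "f x = g x"
  proof (cases "x \<in> \<Union>\<T>")
    case True
    have "continuous_on (closure W) (\<lambda>x. f x - g x)"
      using assms P1_continuous Union_mesh closure_W by (metis continuous_on_diff)
    then have "f x - g x = 0"
      using assms(3) True Union_mesh closure_W
      by (intro continuous_constant_on_closure[of W "\<lambda>x. f x - g x" 0 x]) auto
    then show ?thesis by simp
  qed (use assms P1_outside in metis)
qed

section \<open>Elementwise constant Jacobians and divergences\<close>

lemma P1_jacobian:
  fixes u :: "real^'d \<Rightarrow> real^'d"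
  assumes "u \<in> P1 \<T>" "K \<in> \<T>"
  obtains a A where "\<And>x. x \<in> K \<Longrightarrow> u x = a + A *v x"
    "\<And>x. x \<in> interior K \<Longrightarrow> (u has_derivative (*v) A) (at x)"
proof -
  obtain a L where L: "linear L" "\<And>x. x \<in> K \<Longrightarrow> u x = a + L x"
    using P1_cases[OF assms] by blast
  define A where "A = matrix L"
  have AL: "L = (*v) A" using L(1) by (simp add: A_def fun_eq_iff matrix_works)
  show thesis
  proof (rule that)
    show aA: "u x = a + A *v x" if "x \<in> K" for x using L(2)[OF that] AL by simp
    show "(u has_derivative (*v) A) (at x)" if x: "x \<in> interior K" for x
    proof (rule has_derivative_transform_within_open)
      show "((\<lambda>x. a + A *v x) has_derivative (*v) A) (at x)"
        by (auto intro!: derivative_eq_intros bounded_linear_imp_has_derivative)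
    qed (use x aA interior_subset[of K] in \<open>auto simp: subset_iff\<close>)
  qed
qed

lemma has_derivative_jacobian:
  fixes u :: "real^'d \<Rightarrow> real^'d"
  assumes "u \<in> P1 \<T>" "x \<in> W"
  shows "(u has_derivative (*v) (jacobian u (at x))) (at x)"
proof -
  obtain K where K: "K \<in> \<T>" "x \<in> interior K" using assms W_cell by blast
  show ?thesis using P1_jacobian[OF assms(1) K(1)] K(2) jacobian_eqI by metis
qed

lemma jacobian_add:
  fixes u v :: "real^'d \<Rightarrow> real^'d"
  assumes "u \<in> P1 \<T>" "v \<in> P1 \<T>" "x \<in> W"
  shows "jacobian (u + v) (at x) = jacobian u (at x) + jacobian v (at x)"
proof (rule jacobian_eqI)
  have "((\<lambda>y. u y + v y) has_derivative (\<lambda>h. jacobian u (at x) *v h + jacobian v (at x) *v h)) (at x)"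
    using assms by (intro has_derivative_add has_derivative_jacobian)
  then show "(u + v has_derivative (*v) (jacobian u (at x) + jacobian v (at x))) (at x)"
    by (simp add: plus_fun_def matrix_vector_mult_add_rdistrib[abs_def])
qed

lemma jacobian_scale:
  fixes u :: "real^'d \<Rightarrow> real^'d"
  assumes "u \<in> P1 \<T>" "x \<in> W"
  shows "jacobian (c *\<^sub>R u) (at x) = c *\<^sub>R jacobian u (at x)"
proof (rule jacobian_eqI)
  have "((\<lambda>y. c *\<^sub>R u y) has_derivative (\<lambda>h. c *\<^sub>R (jacobian u (at x) *v h))) (at x)"
    using assms by (intro has_derivative_scaleR_right has_derivative_jacobian)
  then show "(c *\<^sub>R u has_derivative (*v) (c *\<^sub>R jacobian u (at x))) (at x)"
    by (simp add: scaleR_fun_def scaleR_matrix_vector_assoc)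
qed

text \<open>The Jacobian is constant on the interior of each element: continuous on their open
  union, and bounded because it takes finitely many values.\<close>

lemma regular_jacobian:
  fixes u :: "real^'d \<Rightarrow> real^'d"
  assumes u: "u \<in> P1 \<T>"
  shows "regular (\<lambda>x. jacobian u (at x))"
proof -
  have "\<exists>A. \<forall>x\<in>interior K. jacobian u (at x) = A" if "K \<in> \<T>" for K
    using P1_jacobian[OF u that] jacobian_eqI by metis
  then obtain A where A: "\<And>K x. \<lbrakk>K \<in> \<T>; x \<in> interior K\<rbrakk> \<Longrightarrow> jacobian u (at x) = A K"
    by metis
  have "continuous_on (\<Union>K\<in>\<T>. interior K) (\<lambda>x. jacobian u (at x))"
  proof (rule continuous_on_open_UN)
    fix K assume K: "K \<in> \<T>"
    show "continuous_on (interior K) (\<lambda>x. jacobian u (at x))"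
      using A[OF K] by (simp cong: continuous_on_cong)
  qed simp
  then have "continuous_on W (\<lambda>x. jacobian u (at x))"
    by (rule continuous_on_subset) (auto simp: W_def)
  moreover have "(\<lambda>x. jacobian u (at x)) ` W \<subseteq> A ` \<T>"
    using A W_cell by blast
  ultimately show ?thesis
    unfolding regular_def using finite_mesh by (meson bounded_subset finite_imageI finite_imp_bounded)
qed

lemma regular_div:
  assumes "u \<in> P1 \<T>"
  shows "regular (div_at u)"
  unfolding div_at_def[abs_def] trace_eq_inner
  by (intro regular_inner regular_jacobian[OF assms] regular_const)

lemma div_at_add: "\<lbrakk>u \<in> P1 \<T>; v \<in> P1 \<T>; x \<in> W\<rbrakk> \<Longrightarrow> div_at (u + v) x = div_at u x + div_at v x"
  by (simp add: div_at_def jacobian_add trace_eq_inner inner_add_left)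

lemma div_at_scale: "\<lbrakk>u \<in> P1 \<T>; x \<in> W\<rbrakk> \<Longrightarrow> div_at (c *\<^sub>R u) x = c * div_at u x"
  by (simp add: div_at_def jacobian_scale trace_eq_inner)

lemmas regular_intros = regular_mult regular_inner regular_diff regular_jacobian regular_div

section \<open>The forms of the stabilized Stokes problem\<close>

definition grad_form :: "(real^'d \<Rightarrow> real^'d) \<Rightarrow> (real^'d \<Rightarrow> real^'d) \<Rightarrow> real" where
  "grad_form u v = (LINT x:\<Omega>|lebesgue. jacobian u (at x) \<bullet> jacobian v (at x))"

definition mass_form :: "(real^'d \<Rightarrow> real) \<Rightarrow> (real^'d \<Rightarrow> real) \<Rightarrow> real" where
  "mass_form p q = (LINT x:\<Omega>|lebesgue. p x * q x)"

definition div_form :: "(real^'d \<Rightarrow> real) \<Rightarrow> (real^'d \<Rightarrow> real^'d) \<Rightarrow> real" where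
  "div_form p v = (LINT x:\<Omega>|lebesgue. p x * div_at v x)"

lemma P1_add: "\<lbrakk>f \<in> P1 \<T>; g \<in> P1 \<T>\<rbrakk> \<Longrightarrow> f + g \<in> P1 \<T>"
  and P1_scale: "f \<in> P1 \<T> \<Longrightarrow> c *\<^sub>R f \<in> P1 \<T>"
  for f g :: "real^'d \<Rightarrow> 'b::real_normed_vector"
  using subspace_P1 by (blast intro: subspace_add subspace_scale)+

lemma div_form_add_left:
  "\<lbrakk>p \<in> P1 \<T>; p' \<in> P1 \<T>; v \<in> P1 \<T>\<rbrakk> \<Longrightarrow> div_form (p + p') v = div_form p v + div_form p' v"
  unfolding div_form_def
  by (intro lint_add regular_intros) (auto simp: regular_P1 regular_add P1_add distrib_right)

lemma div_form_scale_left: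
  "\<lbrakk>p \<in> P1 \<T>; v \<in> P1 \<T>\<rbrakk> \<Longrightarrow> div_form (c *\<^sub>R p) v = c * div_form p v"
  unfolding div_form_def
  by (intro lint_scale regular_intros) (auto simp: regular_P1 regular_scale P1_scale)

lemma div_form_add_right:
  "\<lbrakk>p \<in> P1 \<T>; v \<in> P1 \<T>; v' \<in> P1 \<T>\<rbrakk> \<Longrightarrow> div_form p (v + v') = div_form p v + div_form p v'"
  unfolding div_form_def
  by (intro lint_add regular_intros) (auto simp: regular_P1 regular_add P1_add div_at_add distrib_left)

lemma div_form_scale_right:
  "\<lbrakk>p \<in> P1 \<T>; v \<in> P1 \<T>\<rbrakk> \<Longrightarrow> div_form p (c *\<^sub>R v) = c * div_form p v"
  unfolding div_form_def
  by (intro lint_scale regular_intros) (auto simp: regular_P1 regular_scale P1_scale div_at_scale)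

lemma subspace_Vh: "subspace (Vh \<Omega> \<T>)"
  by (rule subspaceI)
    (auto simp: Vh_def P1_add P1_scale subspace_0[OF subspace_P1])

lemma subspace_Qh: "subspace (Qh \<Omega> \<T>)"
proof (rule subspaceI)
  show "0 \<in> Qh \<Omega> \<T>"
    by (simp add: Qh_def subspace_0[OF subspace_P1] set_lebesgue_integral_def)
next
  fix p q assume pq: "p \<in> Qh \<Omega> \<T>" "q \<in> Qh \<Omega> \<T>"
  then have P: "p \<in> P1 \<T>" "q \<in> P1 \<T>" by (auto simp: Qh_def)
  have "set_lebesgue_integral lebesgue \<Omega> (p + q) = (LINT x:\<Omega>|lebesgue. p x) + (LINT x:\<Omega>|lebesgue. q x)"
    by (rule lint_add[OF regular_P1[OF P(1)] regular_P1[OF P(2)] regular_P1[OF P1_add[OF P]]]) simp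
  then show "p + q \<in> Qh \<Omega> \<T>" using pq P1_add[OF P] by (simp add: Qh_def)
next
  fix c p assume p: "p \<in> Qh \<Omega> \<T>"
  then have P: "p \<in> P1 \<T>" by (auto simp: Qh_def)
  have "set_lebesgue_integral lebesgue \<Omega> (c *\<^sub>R p) = c * (LINT x:\<Omega>|lebesgue. p x)"
    by (rule lint_scale[OF regular_P1[OF P] regular_P1[OF P1_scale[OF P]]]) simp
  then show "c *\<^sub>R p \<in> Qh \<Omega> \<T>" using p P1_scale[OF P] by (simp add: Qh_def)
qed

lemma Vh_P1: "u \<in> Vh \<Omega> \<T> \<Longrightarrow> u \<in> P1 \<T>"
  and Qh_P1: "p \<in> Qh \<Omega> \<T> \<Longrightarrow> p \<in> P1 \<T>"
  by (auto simp: Vh_def Qh_def)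

lemma connected_mesh: "connected (\<Union>\<T>)"
  using domain_facts(3) Union_mesh by (simp add: connected_imp_connected_closure)

lemma frontier_nonempty: "frontier \<Omega> \<noteq> {}"
  using domain_facts not_bounded_UNIV by (metis frontier_eq_empty)

text \<open>A vanishing gradient makes \<open>u\<close> constant on each element, connectedness
  merges the constants, and the boundary condition makes the common value zero.\<close>

lemma grad_form_definite:
  assumes u: "u \<in> Vh \<Omega> \<T>" and 0: "grad_form u u = 0"
  shows "u = 0"
proof -
  have P: "u \<in> P1 \<T>" using u by (rule Vh_P1)
  have jac0: "jacobian u (at x) = 0" if "x \<in> W" for x
  proof -
    have "jacobian u (at x) \<bullet> jacobian u (at x) = 0"
      using that 0 P unfolding grad_form_def
      by (intro lint_eq_0[where f = "\<lambda>x. jacobian u (at x) \<bullet> jacobian u (at x)"] regular_intros) auto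
    then show ?thesis by simp
  qed
  have "u constant_on K" if K: "K \<in> \<T>" for K
  proof -
    obtain a A where A: "\<And>x. x \<in> K \<Longrightarrow> u x = a + A *v x"
      "\<And>x. x \<in> interior K \<Longrightarrow> (u has_derivative (*v) A) (at x)"
      using P1_jacobian[OF P K] by blast
    \<comment> \<open>One point in both \<open>interior K\<close> and \<open>W\<close> suffices to
      identify the matrix of \<open>u\<close> on all of \<open>K\<close>.\<close>
    obtain x where "x \<in> interior K" "x \<in> W" using cell_meets_W[OF K] by blast
    then have "A = 0" using jac0 jacobian_eqI[OF A(2)] by metis
    then show ?thesis using A(1) by (auto simp: constant_on_def)
  qed
  then have "u constant_on \<Union>\<T>" using P P1_continuous connected_mesh by (intro P1_constant) auto
  then obtain c where c: "\<And>x. x \<in> \<Union>\<T> \<Longrightarrow> u x = c" by (auto simp: constant_on_def)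
  obtain y where y: "y \<in> frontier \<Omega>" using frontier_nonempty by blast
  then have "c = 0"
    using c[of y] u Union_mesh by (simp add: Vh_def frontier_def)
  show "u = 0"
  proof
    fix x show "u x = 0 x"
      using c[of x] P1_outside[OF P, of x] \<open>c = 0\<close> by (cases "x \<in> \<Union>\<T>") auto
  qed
qed

lemma inner_product_grad: "inner_product_on (Vh \<Omega> \<T>) grad_form"
proof (rule inner_product_onI[OF subspace_Vh])
  fix u v w assume "u \<in> Vh \<Omega> \<T>" "v \<in> Vh \<Omega> \<T>" "w \<in> Vh \<Omega> \<T>"
  then have "u \<in> P1 \<T>" "v \<in> P1 \<T>" "w \<in> P1 \<T>" using Vh_P1 by auto
  then show "grad_form (u + v) w = grad_form u w + grad_form v w"
    unfolding grad_form_def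
    by (intro lint_add regular_intros) (auto simp: P1_add jacobian_add inner_add_left)
next
  fix c u w assume "u \<in> Vh \<Omega> \<T>" "w \<in> Vh \<Omega> \<T>"
  then have "u \<in> P1 \<T>" "w \<in> P1 \<T>" using Vh_P1 by auto
  then show "grad_form (c *\<^sub>R u) w = c * grad_form u w"
    unfolding grad_form_def
    by (intro lint_scale regular_intros) (auto simp: P1_scale jacobian_scale)
next
  fix u assume "u \<in> Vh \<Omega> \<T>"
  then show "grad_form u u \<ge> 0"
    unfolding grad_form_def by (intro lint_nonneg regular_intros Vh_P1) auto
qed (use grad_form_definite in \<open>simp_all add: grad_form_def inner_commute\<close>)

lemma mass_form_add:
  "\<lbrakk>p \<in> P1 \<T>; p' \<in> P1 \<T>; q \<in> P1 \<T>\<rbrakk> \<Longrightarrow> mass_form (p + p') q = mass_form p q + mass_form p' q"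
  unfolding mass_form_def
  by (intro lint_add regular_intros) (auto simp: regular_P1 regular_add P1_add distrib_right)

lemma mass_form_scale:
  "\<lbrakk>p \<in> P1 \<T>; q \<in> P1 \<T>\<rbrakk> \<Longrightarrow> mass_form (c *\<^sub>R p) q = c * mass_form p q"
  unfolding mass_form_def
  by (intro lint_scale regular_intros) (auto simp: regular_P1 regular_scale P1_scale)

lemma mass_form_definite:
  assumes p: "p \<in> P1 \<T>" and 0: "mass_form p p = 0"
  shows "p = 0"
proof (rule P1_eq_on_W)
  fix x assume "x \<in> W"
  then have "p x * p x = 0"
    using p 0 unfolding mass_form_def
    by (intro lint_eq_0[where f = "\<lambda>x. p x * p x"] regular_intros) (auto simp: regular_P1)
  then show "p x = 0 x" by simp
qed (use p subspace_0[OF subspace_P1] in auto)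

lemma inner_product_mass: "inner_product_on (Qh \<Omega> \<T>) mass_form"
proof (rule inner_product_onI[OF subspace_Qh])
  show "mass_form p p \<ge> 0" if "p \<in> Qh \<Omega> \<T>" for p
    using that unfolding mass_form_def
    by (intro lint_nonneg regular_intros) (auto simp: regular_P1 Qh_P1)
  show "mass_form p q = mass_form q p" for p q
    by (simp add: mass_form_def mult.commute)
qed (auto simp: mass_form_add mass_form_scale Qh_P1 intro: mass_form_definite)

lemma lagrange_interp_add:
  assumes "\<And>v. v \<in> mesh_nodes \<T> \<Longrightarrow> h v = f v + g v"
  shows "lagrange_interp \<T> h = lagrange_interp \<T> f + lagrange_interp \<T> g"
  using assms by (intro lagrange_interp_eqI P1_add lagrange_interp) (simp_all add: lagrange_interp_node)

lemma lagrange_interp_scale: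
  assumes "\<And>v. v \<in> mesh_nodes \<T> \<Longrightarrow> h v = c * f v"
  shows "lagrange_interp \<T> h = c *\<^sub>R lagrange_interp \<T> f"
  using assms by (intro lagrange_interp_eqI P1_scale lagrange_interp) (simp_all add: lagrange_interp_node)

lemma stab_op_eq:
  assumes "p \<in> P1 \<T>" "q \<in> P1 \<T>"
  shows "stab_op \<Omega> \<T> p q =
    (LINT x:\<Omega>|lebesgue. lagrange_interp \<T> (\<lambda>y. p y * q y) x) - mass_form p q"
  unfolding stab_op_def mass_form_def
  using assms by (intro lint_diff regular_intros) (simp_all add: regular_P1 lagrange_interp)

lemma stab_op_definite:
  assumes p: "p \<in> Qh \<Omega> \<T>" and 0: "stab_op \<Omega> \<T> p p = 0"
  shows "p = 0"
proof -
  have P: "p \<in> P1 \<T>" using p by (rule Qh_P1)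
  let ?I = "lagrange_interp \<T> (\<lambda>y. (p y)\<^sup>2)"
  have WT: "x \<in> \<Union>\<T>" if "x \<in> W" for x using that W_subset Union_mesh closure_subset by blast
  have W: "?I x - (p x)\<^sup>2 = 0" if x: "x \<in> W" for x
  proof (rule lint_eq_0[OF _ _ _ x])
    show "regular (\<lambda>x. ?I x - (p x)\<^sup>2)"
      unfolding power2_eq_square by (intro regular_intros regular_P1[OF lagrange_interp] regular_P1[OF P])
    show "(LINT x:\<Omega>|lebesgue. ?I x - (p x)\<^sup>2) = 0"
      using 0 by (simp add: stab_op_def power2_eq_square)
    show "0 \<le> ?I x - (p x)\<^sup>2" if "x \<in> W" for x
      using square_le_lagrange_interp[OF P WT[OF that]] by simp
  qed
  \<comment> \<open>The midpoint argument evaluates the identity on edges, possibly outside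
    \<open>W\<close>, so it is first extended to the closure.\<close>
  have "continuous_on (closure W) (\<lambda>x. ?I x - (p x)\<^sup>2)"
    unfolding closure_W Union_mesh[symmetric]
    by (intro continuous_intros P1_continuous[OF P] P1_continuous[OF lagrange_interp])
  then have eq: "?I x - (p x)\<^sup>2 = 0" if "x \<in> \<Union>\<T>" for x
    using W that unfolding Union_mesh closure_W[symmetric] by (rule continuous_constant_on_closure)
  have "p constant_on K" if K: "K \<in> \<T>" for K
  proof (rule constant_on_of_square_eq_lagrange_interp[OF P K])
    show "(p x)\<^sup>2 = ?I x" if "x \<in> K" for x using eq[OF UnionI[OF K that]] by simp
  qed
  then have "p constant_on \<Union>\<T>" using P P1_continuous connected_mesh by (intro P1_constant) auto
  then obtain c where c: "\<And>x. x \<in> \<Union>\<T> \<Longrightarrow> p x = c" by (auto simp: constant_on_def)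
  \<comment> \<open>For constant \<open>p\<close> the squared norm is \<open>c\<close> times the
    integral of \<open>p\<close>, which the zero-mean condition annihilates.\<close>
  have "mass_form p p = c * (LINT x:\<Omega>|lebesgue. p x)"
    unfolding mass_form_def
  proof (intro lint_scale regular_intros regular_P1[OF P])
    fix x assume "x \<in> W"
    then show "p x * p x = c * p x" using c[OF WT] by simp
  qed
  then have "mass_form p p = 0" using p by (simp add: Qh_def)
  then show ?thesis using mass_form_definite[OF P] by blast
qed

lemma inner_product_stab: "inner_product_on (Qh \<Omega> \<T>) (stab_op \<Omega> \<T>)"
proof (rule inner_product_onI[OF subspace_Qh])
  fix p p' q assume "p \<in> Qh \<Omega> \<T>" "p' \<in> Qh \<Omega> \<T>" "q \<in> Qh \<Omega> \<T>"
  then have P: "p \<in> P1 \<T>" "p' \<in> P1 \<T>" "q \<in> P1 \<T>" using Qh_P1 by auto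
  have "(LINT x:\<Omega>|lebesgue. lagrange_interp \<T> (\<lambda>y. (p + p') y * q y) x) =
      (LINT x:\<Omega>|lebesgue. lagrange_interp \<T> (\<lambda>y. p y * q y) x) +
      (LINT x:\<Omega>|lebesgue. lagrange_interp \<T> (\<lambda>y. p' y * q y) x)"
    by (intro lint_add regular_P1 lagrange_interp)
      (simp add: lagrange_interp_add[of _ "\<lambda>y. p y * q y" "\<lambda>y. p' y * q y"] distrib_right)
  then show "stab_op \<Omega> \<T> (p + p') q = stab_op \<Omega> \<T> p q + stab_op \<Omega> \<T> p' q"
    using P by (simp add: stab_op_eq P1_add mass_form_add)
next
  fix c p q assume "p \<in> Qh \<Omega> \<T>" "q \<in> Qh \<Omega> \<T>"
  then have P: "p \<in> P1 \<T>" "q \<in> P1 \<T>" using Qh_P1 by auto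
  have "(LINT x:\<Omega>|lebesgue. lagrange_interp \<T> (\<lambda>y. (c *\<^sub>R p) y * q y) x) =
      c * (LINT x:\<Omega>|lebesgue. lagrange_interp \<T> (\<lambda>y. p y * q y) x)"
    by (intro lint_scale regular_P1 lagrange_interp)
      (simp add: lagrange_interp_scale[of _ c "\<lambda>y. p y * q y"])
  then show "stab_op \<Omega> \<T> (c *\<^sub>R p) q = c * stab_op \<Omega> \<T> p q"
    using P by (simp add: stab_op_eq P1_scale mass_form_scale right_diff_distrib)
next
  fix p assume "p \<in> Qh \<Omega> \<T>"
  then have P: "p \<in> P1 \<T>" by (rule Qh_P1)
  have "p x * p x \<le> lagrange_interp \<T> (\<lambda>y. p y * p y) x" if "x \<in> W" for x
    using square_le_lagrange_interp[OF P, of x] that W_subset Union_mesh closure_subset[of \<Omega>]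
    by (auto simp: power2_eq_square)
  then show "stab_op \<Omega> \<T> p p \<ge> 0"
    unfolding stab_op_def
    by (intro lint_nonneg regular_intros regular_P1[OF lagrange_interp] regular_P1[OF P]) auto
qed (use stab_op_definite in \<open>simp_all add: stab_op_def mult.commute\<close>)

lemma finite_span_Qh: "\<exists>B. finite B \<and> Qh \<Omega> \<T> \<subseteq> span B"
  using P1_finite_span[where 'b = real] Qh_P1 by blast

lemma finite_span_Xh: "\<exists>B. finite B \<and> Xh \<Omega> \<T> \<subseteq> span B"
proof -
  have "\<exists>B. finite B \<and> Vh \<Omega> \<T> \<subseteq> span B"
    using P1_finite_span[where 'b = "real^'d"] Vh_P1 by blast
  then show ?thesis unfolding Xh_def using finite_span_Qh by (rule finite_span_Times)
qed

lemma stokes_op_eq: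
  "stokes_op \<Omega> \<T> (u, p) (v, q) = grad_form u v - div_form p v + div_form q u + stab_op \<Omega> \<T> p q"
  by (simp add: stokes_op_def grad_form_def div_form_def)

lemma bilinear_stokes_op: "bilinear_on (Xh \<Omega> \<T>) (stokes_op \<Omega> \<T>)"
proof -
  interpret V: inner_product_on "Vh \<Omega> \<T>" grad_form by (rule inner_product_grad)
  interpret Q: inner_product_on "Qh \<Omega> \<T>" "stab_op \<Omega> \<T>" by (rule inner_product_stab)
  show ?thesis
    unfolding bilinear_on_def linear_map_on_def
    by (auto simp: Xh_def stokes_op_eq Vh_P1 Qh_P1 div_form_add_left div_form_add_right
        div_form_scale_left div_form_scale_right distrib_left right_diff_distrib
        V.add_left V.add_right V.scale_left V.scale_right
        Q.add_left Q.add_right Q.scale_left Q.scale_right)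
qed

lemma normQ_eq: "normQ \<Omega> p = sqrt (mass_form p p)"
  by (simp add: normQ_def mass_form_def power2_eq_square)

lemma normX_eq:
  assumes "z \<in> Xh \<Omega> \<T>"
  shows "normX \<Omega> z = sqrt ((\<lambda>(u, p) (v, q). grad_form u v + mass_form p q) z z)"
proof -
  obtain u p where z: "z = (u, p)" "u \<in> Vh \<Omega> \<T>" "p \<in> Qh \<Omega> \<T>" using assms by (auto simp: Xh_def)
  interpret V: inner_product_on "Vh \<Omega> \<T>" grad_form by (rule inner_product_grad)
  interpret Q: inner_product_on "Qh \<Omega> \<T>" mass_form by (rule inner_product_mass)
  have "normV \<Omega> u = sqrt (grad_form u u)"
    by (simp add: normV_def grad_form_def power2_norm_eq_inner)
  \<comment> \<open>Nonnegativity of both forms is what cancels the inner square roots of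
    \<open>normV\<close> and \<open>normQ\<close> against the squares.\<close>
  then show ?thesis
    using z V.nonneg[of u] Q.nonneg[of p] by (simp add: normX_def normQ_eq)
qed

end

theorem corollary3p9:
  fixes \<Omega> :: "(real^'d) set" and \<T> :: "(real^'d) set set"
  assumes "CARD('d) \<in> {2, 3}"
    and "polyhedral_domain \<Omega>"
    and "conforming_mesh \<Omega> \<T>"
  shows "stab_op \<Omega> \<T> \<in> bounded_linear_maps_to_dual (Qh \<Omega> \<T>) (normQ \<Omega>) (Qh \<Omega> \<T>) (normQ \<Omega>) \<and>
    stokes_op \<Omega> \<T> \<in> bounded_linear_maps_to_dual (Xh \<Omega> \<T>) (normX \<Omega>) (Xh \<Omega> \<T>) (normX \<Omega>) \<and>
    linearly_mapped_coercive (Xh \<Omega> \<T>) (normX \<Omega>) (Xh \<Omega> \<T>) (normX \<Omega>) (stokes_op \<Omega> \<T>)"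
proof -
  interpret fem \<Omega> \<T> using assms by unfold_locales
  interpret Q: inner_product_on "Qh \<Omega> \<T>" mass_form by (rule inner_product_mass)
  interpret T: inner_product_on "Qh \<Omega> \<T>" "stab_op \<Omega> \<T>" by (rule inner_product_stab)
  have N: "inner_product_on (Xh \<Omega> \<T>) (\<lambda>(u, p) (v, q). grad_form u v + mass_form p q)"
    unfolding Xh_def by (rule inner_product_on_Times[OF inner_product_grad inner_product_mass])
  have S: "inner_product_on (Xh \<Omega> \<T>) (\<lambda>(u, p) (v, q). grad_form u v + stab_op \<Omega> \<T> p q)"
    unfolding Xh_def by (rule inner_product_on_Times[OF inner_product_grad inner_product_stab])
  obtain B where B: "finite B" "Qh \<Omega> \<T> \<subseteq> span B" using finite_span_Qh by blast
  obtain D where D: "finite D" "Xh \<Omega> \<T> \<subseteq> span D" using finite_span_Xh by blast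
  have stab: "stab_op \<Omega> \<T> \<in> bounded_linear_maps_to_dual (Qh \<Omega> \<T>) (normQ \<Omega>) (Qh \<Omega> \<T>) (normQ \<Omega>)"
    by (rule Q.bounded_linear_maps_to_dual[OF T.bil B normQ_eq])
  have stokes: "stokes_op \<Omega> \<T> \<in>
      bounded_linear_maps_to_dual (Xh \<Omega> \<T>) (normX \<Omega>) (Xh \<Omega> \<T>) (normX \<Omega>)"
    by (rule inner_product_on.bounded_linear_maps_to_dual[OF N bilinear_stokes_op D normX_eq])
  have "linearly_mapped_coercive (Xh \<Omega> \<T>) (normX \<Omega>) (Xh \<Omega> \<T>) (normX \<Omega>) (stokes_op \<Omega> \<T>)"
  proof (rule linearly_mapped_coercive_of_definite[OF N S D normX_eq])
    show "stokes_op \<Omega> \<T> z z = (\<lambda>(u, p) (v, q). grad_form u v + stab_op \<Omega> \<T> p q) z z" for z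
      by (cases z) (simp add: stokes_op_eq)
    show "stokes_op \<Omega> \<T> ` Xh \<Omega> \<T> \<subseteq> dual_space (Xh \<Omega> \<T>) (normX \<Omega>)"
      using stokes by (simp add: bounded_linear_maps_to_dual_def)
  qed
  with stab stokes show ?thesis by blast
qed

end
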